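(* Let $R$ be a commutative Noetherian local ring and let $M$ be a nonfree torsionless finitely generated $R$-module whose presentation matrix is symmetric, i.e. there is an exact sequence $R^n\xrightarrow{A}R^n\to M\to 0$ with $A^T=A$. Then for every nonzero finitely generated $R$-module $N$, $\operatorname{pd}_R(M\otimes_R N)\ne 1$.
   Context: A module $M$ is torsionless if the natural map $M\to M^{**}$ is injective, where $(-)^*=\operatorname{Hom}_R(-,R)$. $A^T$ is the transpose of the matrix $A$. $\operatorname{pd}_R$ denotes projective dimension. *)

theory Defs
  imports "HOL-Algebra.QuotRing" "HOL-Algebra.Ring_Divisibility" "HOL-Algebra.Module"
    "HOL-Library.Extended_Nat"
begin

locale local_ring = cring +
  assumes unique_maximal_ideal: "\<exists>!I. maximalideal I R"

definition module_homs ::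
    "('a, 'r) ring_scheme \<Rightarrow> ('a, 'b, 'm) module_scheme \<Rightarrow> ('a, 'c, 'n) module_scheme \<Rightarrow> ('b \<Rightarrow> 'c) set"
  where "module_homs R M N =
    {h \<in> hom (add_monoid M) (add_monoid N).
       \<forall>a \<in> carrier R. \<forall>x \<in> carrier M. h (a \<odot>\<^bsub>M\<^esub> x) = a \<odot>\<^bsub>N\<^esub> h x}"

definition submodule_span ::
    "('a, 'r) ring_scheme \<Rightarrow> ('a, 'b, 'm) module_scheme \<Rightarrow> 'b set \<Rightarrow> 'b set"
  where "submodule_span R M S = \<Inter>{H. submodule H R M \<and> S \<subseteq> H}"

definition finitely_generated ::
    "('a, 'r) ring_scheme \<Rightarrow> ('a, 'b, 'm) module_scheme \<Rightarrow> bool"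
  where "finitely_generated R M \<longleftrightarrow>
    (\<exists>S. finite S \<and> S \<subseteq> carrier M \<and> submodule_span R M S = carrier M)"


section \<open>Free modules\<close>

text \<open>
  The direct sum of copies of \<open>R\<close> indexed by the set \<open>X\<close>. Its elements are the total functions of
  finite support that vanish outside \<open>X\<close>; in particular \<open>free_module R {..<n}\<close> is the module of
  \<open>n\<close>-tuples. A module record also has fields for a multiplication and a unit; they play no role
  in the notion of a module and are left unspecified here and below.
\<close>

definition free_module :: "('a, 'r) ring_scheme \<Rightarrow> 'x set \<Rightarrow> ('a, 'x \<Rightarrow> 'a) module"
  where "free_module R X =
    \<lparr> carrier = {f. (\<forall>x\<in>X. f x \<in> carrier R) \<and> (\<forall>x. x \<notin> X \<longrightarrow> f x = \<zero>\<^bsub>R\<^esub>) \<and> finite {x. f x \<noteq> \<zero>\<^bsub>R\<^esub>}},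
      mult = undefined, one = undefined,
      zero = (\<lambda>x. \<zero>\<^bsub>R\<^esub>), add = (\<lambda>f g x. f x \<oplus>\<^bsub>R\<^esub> g x),
      smult = (\<lambda>a f x. a \<otimes>\<^bsub>R\<^esub> f x) \<rparr>"

definition lin_comb ::
    "('a, 'r) ring_scheme \<Rightarrow> ('a, 'b, 'm) module_scheme \<Rightarrow> ('x \<Rightarrow> 'b) \<Rightarrow> ('x \<Rightarrow> 'a) \<Rightarrow> 'b"
  where "lin_comb R M v f = (\<Oplus>\<^bsub>M\<^esub> x \<in> {x. f x \<noteq> \<zero>\<^bsub>R\<^esub>}. f x \<odot>\<^bsub>M\<^esub> v x)"

definition is_free :: "('a, 'r) ring_scheme \<Rightarrow> ('a, 'b, 'm) module_scheme \<Rightarrow> bool"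
  where "is_free R M \<longleftrightarrow>
    (\<exists>B \<subseteq> carrier M. bij_betw (lin_comb R M (\<lambda>b. b)) (carrier (free_module R B)) (carrier M))"

definition matrix_map ::
    "('a, 'r) ring_scheme \<Rightarrow> nat \<Rightarrow> (nat \<Rightarrow> nat \<Rightarrow> 'a) \<Rightarrow> (nat \<Rightarrow> 'a) \<Rightarrow> (nat \<Rightarrow> 'a)"
  where "matrix_map R n A v =
    (\<lambda>i. if i < n then (\<Oplus>\<^bsub>R\<^esub> j \<in> {..<n}. A i j \<otimes>\<^bsub>R\<^esub> v j) else \<zero>\<^bsub>R\<^esub>)"


section \<open>Duals and torsionless modules\<close>

definition regular_module :: "('a, 'r) ring_scheme \<Rightarrow> ('a, 'a) module"
  where "regular_module R =
    \<lparr> carrier = carrier R, mult = mult R, one = one R, zero = zero R, add = add R,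
      smult = mult R \<rparr>"

text \<open>Homomorphisms are made extensional so that equality is equality on the carrier.\<close>

definition hom_module ::
    "('a, 'r) ring_scheme \<Rightarrow> ('a, 'b, 'm) module_scheme \<Rightarrow> ('a, 'c, 'n) module_scheme
      \<Rightarrow> ('a, 'b \<Rightarrow> 'c) module"
  where "hom_module R M N =
    \<lparr> carrier = module_homs R M N \<inter> extensional (carrier M),
      mult = undefined, one = undefined,
      zero = (\<lambda>x\<in>carrier M. \<zero>\<^bsub>N\<^esub>), add = (\<lambda>f g. \<lambda>x\<in>carrier M. f x \<oplus>\<^bsub>N\<^esub> g x),
      smult = (\<lambda>a f. \<lambda>x\<in>carrier M. a \<odot>\<^bsub>N\<^esub> f x) \<rparr>"

definition dual_module ::
    "('a, 'r) ring_scheme \<Rightarrow> ('a, 'b, 'm) module_scheme \<Rightarrow> ('a, 'b \<Rightarrow> 'a) module"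
  where "dual_module R M = hom_module R M (regular_module R)"

definition bidual_map ::
    "('a, 'r) ring_scheme \<Rightarrow> ('a, 'b, 'm) module_scheme \<Rightarrow> 'b \<Rightarrow> (('b \<Rightarrow> 'a) \<Rightarrow> 'a)"
  where "bidual_map R M x = (\<lambda>f\<in>carrier (dual_module R M). f x)"

definition torsionless :: "('a, 'r) ring_scheme \<Rightarrow> ('a, 'b, 'm) module_scheme \<Rightarrow> bool"
  where "torsionless R M \<longleftrightarrow> inj_on (bidual_map R M) (carrier M)"


section \<open>Quotients and tensor products\<close>

definition quotient_module ::
    "('a, 'r) ring_scheme \<Rightarrow> ('a, 'b, 'm) module_scheme \<Rightarrow> 'b set \<Rightarrow> ('a, 'b set) module"
  where "quotient_module R M H =
    \<lparr> carrier = a_rcosets\<^bsub>M\<^esub> H, mult = undefined, one = undefined,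
      zero = H, add = set_add M, smult = (\<lambda>a C. \<Union>x\<in>C. H +>\<^bsub>M\<^esub> (a \<odot>\<^bsub>M\<^esub> x)) \<rparr>"

definition free_gen :: "('a, 'r) ring_scheme \<Rightarrow> 'x \<Rightarrow> 'x \<Rightarrow> 'a"
  where "free_gen R x = (\<lambda>y. if y = x then \<one>\<^bsub>R\<^esub> else \<zero>\<^bsub>R\<^esub>)"

definition tensor_relations ::
    "('a, 'r) ring_scheme \<Rightarrow> ('a, 'b, 'm) module_scheme \<Rightarrow> ('a, 'c, 'n) module_scheme
      \<Rightarrow> ('b \<times> 'c \<Rightarrow> 'a) set"
  where "tensor_relations R M N =
    (let F = free_module R (carrier M \<times> carrier N); e = (\<lambda>x y. free_gen R (x, y)) in
      {e (x \<oplus>\<^bsub>M\<^esub> x') y \<ominus>\<^bsub>F\<^esub> (e x y \<oplus>\<^bsub>F\<^esub> e x' y) |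
         x x' y. x \<in> carrier M \<and> x' \<in> carrier M \<and> y \<in> carrier N} \<union>
      {e x (y \<oplus>\<^bsub>N\<^esub> y') \<ominus>\<^bsub>F\<^esub> (e x y \<oplus>\<^bsub>F\<^esub> e x y') |
         x y y'. x \<in> carrier M \<and> y \<in> carrier N \<and> y' \<in> carrier N} \<union>
      {e (a \<odot>\<^bsub>M\<^esub> x) y \<ominus>\<^bsub>F\<^esub> (a \<odot>\<^bsub>F\<^esub> e x y) |
         a x y. a \<in> carrier R \<and> x \<in> carrier M \<and> y \<in> carrier N} \<union>
      {e x (a \<odot>\<^bsub>N\<^esub> y) \<ominus>\<^bsub>F\<^esub> (a \<odot>\<^bsub>F\<^esub> e x y) |
         a x y. a \<in> carrier R \<and> x \<in> carrier M \<and> y \<in> carrier N})"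

definition tensor_product ::
    "('a, 'r) ring_scheme \<Rightarrow> ('a, 'b, 'm) module_scheme \<Rightarrow> ('a, 'c, 'n) module_scheme
      \<Rightarrow> ('a, ('b \<times> 'c \<Rightarrow> 'a) set) module"
  where "tensor_product R M N =
    (let F = free_module R (carrier M \<times> carrier N) in
      quotient_module R F (submodule_span R F (tensor_relations R M N)))"


section \<open>Projective modules and projective dimension\<close>

text \<open>
  Projectivity is the lifting property against surjections. A definition in HOL cannot quantify over
  types, so the test modules \<open>X\<close> and \<open>Y\<close> live on fixed types. These are large enough to contain the
  canonical surjection from the free module on \<open>carrier P\<close> onto \<open>P\<close>, hence nothing is lost:
  theorem \<open>projective_lifting\<close> below gives the lifting property for test modules on arbitrary types.
\<close>

definition projective :: "('a, 'r) ring_scheme \<Rightarrow> ('a, 'u) module \<Rightarrow> bool"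
  where "projective R P \<longleftrightarrow> module R P \<and>
    (\<forall>(X :: ('a, 'u \<Rightarrow> 'a) module) (Y :: ('a, 'u) module) g f.
       module R X \<longrightarrow> module R Y \<longrightarrow> g \<in> module_homs R X Y \<longrightarrow> g ` carrier X = carrier Y \<longrightarrow>
       f \<in> module_homs R P Y \<longrightarrow>
       (\<exists>h \<in> module_homs R P X. \<forall>p \<in> carrier P. g (h p) = f p))"

text \<open>
  An augmented complex \<open>\<dots> \<rightarrow> P 1 \<rightarrow> P 0 \<rightarrow> L \<rightarrow> 0\<close>, with \<open>d i\<close> mapping \<open>P (i + 1)\<close> to \<open>P i\<close> and
  augmentation \<open>e\<close>, that is exact with all \<open>P i\<close> projective.
\<close>

definition projective_resolution ::
    "('a, 'r) ring_scheme \<Rightarrow> ('a, 'l, 'm) module_scheme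
      \<Rightarrow> (nat \<Rightarrow> ('a, 'u) module) \<Rightarrow> (nat \<Rightarrow> 'u \<Rightarrow> 'u) \<Rightarrow> ('u \<Rightarrow> 'l) \<Rightarrow> bool"
  where "projective_resolution R L P d e \<longleftrightarrow>
    (\<forall>i. projective R (P i)) \<and>
    (\<forall>i. d i \<in> module_homs R (P (Suc i)) (P i)) \<and>
    e \<in> module_homs R (P 0) L \<and>
    e ` carrier (P 0) = carrier L \<and>
    a_kernel (P 0) L e = d 0 ` carrier (P 1) \<and>
    (\<forall>i. a_kernel (P (Suc i)) (P i) (d i) = d (Suc i) ` carrier (P (Suc (Suc i))))"

text \<open>
  The infimum of the lengths of the projective resolutions of \<open>L\<close>; it is \<open>\<infinity>\<close> if there is no finite
  one, and \<open>0\<close> for the zero module.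

  The modules of a resolution have to live on one fixed type. The type \<open>nat + 'a + 'l \<Rightarrow> 'a\<close>
  is always large enough: if \<open>L\<close> is a module over a nonzero ring and has a projective resolution of
  length \<open>n\<close> on any types whatsoever, then by Schanuel's lemma the \<open>n\<close>-th syzygy of \<open>L\<close> with respect
  to any choice of free modules is projective. Successively taking the free module on the elements of
  the preceding syzygy, all sets that occur have cardinality at most that of the index type
  \<open>nat + 'a + 'l\<close>, so all these free modules, and their submodules, have copies on the chosen type.
\<close>

definition proj_dim :: "('a, 'r) ring_scheme \<Rightarrow> ('a, 'l, 'm) module_scheme \<Rightarrow> enat"
  where "proj_dim R L =
    (INF n \<in> {n. \<exists>(P :: nat \<Rightarrow> ('a, nat + 'a + 'l \<Rightarrow> 'a) module) d e.
        projective_resolution R L P d e \<and> (\<forall>i>n. carrier (P i) = {\<zero>\<^bsub>P i\<^esub>})}. enat n)"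

section \<open>Basic properties\<close>

lemma free_module_is_module:
  fixes X :: "'x set"
  assumes "cring R"
  shows "module R (free_module R X)"
proof -
  interpret cring R by fact
  let ?F = "free_module R X"
  have memI: "f \<in> carrier ?F"
    if "\<And>x. f x \<in> carrier R" "finite S" "S \<subseteq> X" "\<And>x. x \<notin> S \<Longrightarrow> f x = \<zero>\<^bsub>R\<^esub>"
    for f :: "'x \<Rightarrow> 'a" and S
  proof -
    have "{x. f x \<noteq> \<zero>\<^bsub>R\<^esub>} \<subseteq> S" using that(4) by blast
    with that show ?thesis by (auto simp: free_module_def intro: finite_subset)
  qed
  have in_R: "f x \<in> carrier R" if "f \<in> carrier ?F" for f :: "'x \<Rightarrow> 'a" and x
    using that by (cases "x \<in> X") (auto simp: free_module_def)
  have supp: "\<exists>S. finite S \<and> S \<subseteq> X \<and> (\<forall>x. x \<notin> S \<longrightarrow> f x = \<zero>\<^bsub>R\<^esub>)" if "f \<in> carrier ?F" for f :: "'x \<Rightarrow> 'a"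
    using that by (intro exI[of _ "{x. f x \<noteq> \<zero>\<^bsub>R\<^esub>}"]) (auto simp: free_module_def)
  have ops: "f \<oplus>\<^bsub>?F\<^esub> g = (\<lambda>x. f x \<oplus>\<^bsub>R\<^esub> g x)" "a \<odot>\<^bsub>?F\<^esub> f = (\<lambda>x. a \<otimes>\<^bsub>R\<^esub> f x)"
    "\<zero>\<^bsub>?F\<^esub> = (\<lambda>x. \<zero>\<^bsub>R\<^esub>)" for f g a
    by (simp_all add: free_module_def)
  have add_closed: "f \<oplus>\<^bsub>?F\<^esub> g \<in> carrier ?F" if f: "f \<in> carrier ?F" and g: "g \<in> carrier ?F" for f g
  proof -
    obtain S T where "finite S" "S \<subseteq> X" "\<forall>x. x \<notin> S \<longrightarrow> f x = \<zero>\<^bsub>R\<^esub>"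
      and "finite T" "T \<subseteq> X" "\<forall>x. x \<notin> T \<longrightarrow> g x = \<zero>\<^bsub>R\<^esub>"
      using supp[OF f] supp[OF g] by blast
    then show ?thesis
      using in_R[OF f] in_R[OF g] by (intro memI[of _ "S \<union> T"]) (simp_all add: ops)
  qed
  have smult_closed: "a \<odot>\<^bsub>?F\<^esub> f \<in> carrier ?F" if f: "f \<in> carrier ?F" and a: "a \<in> carrier R" for f a
  proof -
    obtain S where "finite S" "S \<subseteq> X" "\<forall>x. x \<notin> S \<longrightarrow> f x = \<zero>\<^bsub>R\<^esub>"
      using supp[OF f] by blast
    then show ?thesis
      using in_R[OF f] a by (intro memI[of _ S]) (simp_all add: ops)
  qed
  have zero_closed: "\<zero>\<^bsub>?F\<^esub> \<in> carrier ?F" by (rule memI[of _ "{}"]) (simp_all add: ops)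
  have neg: "\<exists>g \<in> carrier ?F. g \<oplus>\<^bsub>?F\<^esub> f = \<zero>\<^bsub>?F\<^esub>" if f: "f \<in> carrier ?F" for f
  proof
    show "(\<ominus>\<^bsub>R\<^esub> \<one>\<^bsub>R\<^esub>) \<odot>\<^bsub>?F\<^esub> f \<in> carrier ?F" using f by (simp add: smult_closed)
    show "(\<ominus>\<^bsub>R\<^esub> \<one>\<^bsub>R\<^esub>) \<odot>\<^bsub>?F\<^esub> f \<oplus>\<^bsub>?F\<^esub> f = \<zero>\<^bsub>?F\<^esub>"
      using in_R[OF f] by (simp add: ops l_minus l_neg)
  qed
  have "abelian_group ?F"
  proof (rule abelian_groupI)
    fix f g h assume fgh: "f \<in> carrier ?F" "g \<in> carrier ?F" "h \<in> carrier ?F"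
    note [simp] = in_R[OF fgh(1)] in_R[OF fgh(2)] in_R[OF fgh(3)]
    show "(f \<oplus>\<^bsub>?F\<^esub> g) \<oplus>\<^bsub>?F\<^esub> h = f \<oplus>\<^bsub>?F\<^esub> (g \<oplus>\<^bsub>?F\<^esub> h)"
      by (simp add: ops a_assoc)
  next
    fix f g assume fg: "f \<in> carrier ?F" "g \<in> carrier ?F"
    then show "f \<oplus>\<^bsub>?F\<^esub> g = g \<oplus>\<^bsub>?F\<^esub> f"
      using in_R[OF fg(1)] in_R[OF fg(2)] by (simp add: ops a_comm)
  next
    fix f assume f: "f \<in> carrier ?F"
    show "\<zero>\<^bsub>?F\<^esub> \<oplus>\<^bsub>?F\<^esub> f = f" using in_R[OF f] by (simp add: ops)
  qed (fact add_closed zero_closed neg)+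
  then show ?thesis
  proof (intro moduleI)
    fix a b f g assume a: "a \<in> carrier R" and b: "b \<in> carrier R"
      and f: "f \<in> carrier ?F" and g: "g \<in> carrier ?F"
    show "(a \<oplus>\<^bsub>R\<^esub> b) \<odot>\<^bsub>?F\<^esub> f = a \<odot>\<^bsub>?F\<^esub> f \<oplus>\<^bsub>?F\<^esub> b \<odot>\<^bsub>?F\<^esub> f"
      and "a \<odot>\<^bsub>?F\<^esub> (f \<oplus>\<^bsub>?F\<^esub> g) = a \<odot>\<^bsub>?F\<^esub> f \<oplus>\<^bsub>?F\<^esub> a \<odot>\<^bsub>?F\<^esub> g"
      and "(a \<otimes>\<^bsub>R\<^esub> b) \<odot>\<^bsub>?F\<^esub> f = a \<odot>\<^bsub>?F\<^esub> (b \<odot>\<^bsub>?F\<^esub> f)"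
      using a b in_R[OF f] in_R[OF g] by (simp_all add: ops l_distr r_distr m_assoc)
  next
    fix f assume f: "f \<in> carrier ?F"
    show "\<one>\<^bsub>R\<^esub> \<odot>\<^bsub>?F\<^esub> f = f" using in_R[OF f] by (simp add: ops)
  qed (use assms smult_closed in simp_all)
qed

lemma (in module) lin_comb_eq_finsum:
  assumes "finite S" "{x. f x \<noteq> \<zero>} \<subseteq> S"
    and "\<And>x. x \<in> S \<Longrightarrow> f x \<in> carrier R" "\<And>x. x \<in> S \<Longrightarrow> v x \<in> carrier M"
  shows "lin_comb R M v f = (\<Oplus>\<^bsub>M\<^esub> x \<in> S. f x \<odot>\<^bsub>M\<^esub> v x)"
  unfolding lin_comb_def
  by (rule M.add.finprod_mono_neutral_cong_left) (use assms in auto)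

lemma free_module_memD:
  assumes "cring R" "f \<in> carrier (free_module R X)"
  shows "f x \<in> carrier R" and "finite {x. f x \<noteq> \<zero>\<^bsub>R\<^esub>}" and "{x. f x \<noteq> \<zero>\<^bsub>R\<^esub>} \<subseteq> X"
proof -
  interpret cring R by fact
  show "f x \<in> carrier R" using assms(2) by (cases "x \<in> X") (auto simp: free_module_def)
qed (use assms(2) in \<open>auto simp: free_module_def\<close>)

lemma (in module) lin_comb_hom:
  assumes v: "\<And>x. x \<in> X \<Longrightarrow> v x \<in> carrier M"
  shows "lin_comb R M v \<in> module_homs R (free_module R X) M"
proof -
  note D = free_module_memD[OF R.is_cring, where X = X]
  have closed: "lin_comb R M v f \<in> carrier M" if "f \<in> carrier (free_module R X)" for f
    unfolding lin_comb_def using D[OF that] v by (auto intro!: M.finsum_closed)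
  have add: "lin_comb R M v (\<lambda>x. f x \<oplus> g x) = lin_comb R M v f \<oplus>\<^bsub>M\<^esub> lin_comb R M v g"
    if f: "f \<in> carrier (free_module R X)" and g: "g \<in> carrier (free_module R X)" for f g
  proof -
    define S where "S = {x. f x \<noteq> \<zero>} \<union> {x. g x \<noteq> \<zero>}"
    have S: "finite S" "S \<subseteq> X" using D[OF f] D[OF g] by (auto simp: S_def)
    have *: "lin_comb R M v h = (\<Oplus>\<^bsub>M\<^esub> x \<in> S. h x \<odot>\<^bsub>M\<^esub> v x)"
      if "{x. h x \<noteq> \<zero>} \<subseteq> S" "\<And>x. h x \<in> carrier R" for h
      by (rule lin_comb_eq_finsum) (use S v that in auto)
    have 1: "{x. f x \<oplus> g x \<noteq> \<zero>} \<subseteq> S" by (auto simp: S_def)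
    have 2: "{x. f x \<noteq> \<zero>} \<subseteq> S" "{x. g x \<noteq> \<zero>} \<subseteq> S" by (auto simp: S_def)
    have "lin_comb R M v (\<lambda>x. f x \<oplus> g x) = (\<Oplus>\<^bsub>M\<^esub> x \<in> S. (f x \<oplus> g x) \<odot>\<^bsub>M\<^esub> v x)"
      using *[OF 1] D(1)[OF f] D(1)[OF g] by simp
    also have "\<dots> = (\<Oplus>\<^bsub>M\<^esub> x \<in> S. f x \<odot>\<^bsub>M\<^esub> v x \<oplus>\<^bsub>M\<^esub> g x \<odot>\<^bsub>M\<^esub> v x)"
      by (rule M.finsum_cong') (use S v D(1)[OF f] D(1)[OF g] in \<open>auto simp: smult_l_distr\<close>)
    also have "\<dots> = (\<Oplus>\<^bsub>M\<^esub> x \<in> S. f x \<odot>\<^bsub>M\<^esub> v x) \<oplus>\<^bsub>M\<^esub> (\<Oplus>\<^bsub>M\<^esub> x \<in> S. g x \<odot>\<^bsub>M\<^esub> v x)"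
      by (rule M.finsum_addf) (use S v D(1)[OF f] D(1)[OF g] in auto)
    also have "\<dots> = lin_comb R M v f \<oplus>\<^bsub>M\<^esub> lin_comb R M v g"
      using *[OF 2(1)] *[OF 2(2)] D(1)[OF f] D(1)[OF g] by simp
    finally show ?thesis .
  qed
  have smult: "lin_comb R M v (\<lambda>x. a \<otimes> f x) = a \<odot>\<^bsub>M\<^esub> lin_comb R M v f"
    if f: "f \<in> carrier (free_module R X)" and a: "a \<in> carrier R" for f a
  proof -
    define S where "S = {x. f x \<noteq> \<zero>}"
    have S: "finite S" "S \<subseteq> X" using D[OF f] by (auto simp: S_def)
    have "lin_comb R M v (\<lambda>x. a \<otimes> f x) = (\<Oplus>\<^bsub>M\<^esub> x \<in> S. (a \<otimes> f x) \<odot>\<^bsub>M\<^esub> v x)"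
      by (rule lin_comb_eq_finsum) (use S v a D(1)[OF f] in \<open>auto simp: S_def\<close>)
    also have "\<dots> = (\<Oplus>\<^bsub>M\<^esub> x \<in> S. a \<odot>\<^bsub>M\<^esub> (f x \<odot>\<^bsub>M\<^esub> v x))"
      by (rule M.finsum_cong') (use S v a D(1)[OF f] in \<open>auto simp: smult_assoc1\<close>)
    also have "\<dots> = a \<odot>\<^bsub>M\<^esub> (\<Oplus>\<^bsub>M\<^esub> x \<in> S. f x \<odot>\<^bsub>M\<^esub> v x)"
      by (rule finsum_smult_ldistr[symmetric]) (use S v a D(1)[OF f] in auto)
    finally show ?thesis by (simp add: lin_comb_def S_def)
  qed
  show ?thesis
    unfolding module_homs_def hom_def
    using closed add smult by (auto simp: free_module_def)
qed

lemma module_homs_finsum: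
  assumes "module R M" "module R N" "h \<in> module_homs R M N" "finite S"
    and "\<And>x. x \<in> S \<Longrightarrow> v x \<in> carrier M"
  shows "h (\<Oplus>\<^bsub>M\<^esub> x \<in> S. v x) = (\<Oplus>\<^bsub>N\<^esub> x \<in> S. h (v x))"
proof -
  interpret M: module R M by fact
  interpret N: module R N by fact
  have hom: "group_hom (add_monoid M) (add_monoid N) h"
    using assms(3) M.M.a_group N.M.a_group
    by (auto simp: group_hom_def group_hom_axioms_def module_homs_def)
  have zero: "h \<zero>\<^bsub>M\<^esub> = \<zero>\<^bsub>N\<^esub>" using group_hom.hom_one[OF hom] by simp
  have cl: "h x \<in> carrier N" if "x \<in> carrier M" for x
    using group_hom.hom_closed[OF hom] that by simp
  have add: "h (x \<oplus>\<^bsub>M\<^esub> y) = h x \<oplus>\<^bsub>N\<^esub> h y" if "x \<in> carrier M" "y \<in> carrier M" for x y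
    using group_hom.hom_mult[OF hom] that by simp
  show ?thesis
    using assms(4,5)
  proof (induction S rule: finite_induct)
    case empty
    show ?case using zero by simp
  next
    case (insert s S)
    have "v \<in> S \<rightarrow> carrier M" "(\<lambda>x. h (v x)) \<in> S \<rightarrow> carrier N"
      using insert.prems cl by auto
    with insert cl add show ?case by (simp add: M.M.finsum_closed)
  qed
qed

lemma module_homs_lin_comb:
  assumes "module R M" "module R N" "h \<in> module_homs R M N"
    and "\<And>x. x \<in> X \<Longrightarrow> v x \<in> carrier M" and f: "f \<in> carrier (free_module R X)"
  shows "h (lin_comb R M v f) = lin_comb R N (\<lambda>x. h (v x)) f"
proof -
  interpret M: module R M by fact
  interpret N: module R N by fact
  note D = free_module_memD[OF M.R.is_cring f]
  have v: "v x \<in> carrier M" if "f x \<noteq> \<zero>\<^bsub>R\<^esub>" for x using D(3) assms(4) that by blast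
  have "h (lin_comb R M v f) = (\<Oplus>\<^bsub>N\<^esub> x \<in> {x. f x \<noteq> \<zero>\<^bsub>R\<^esub>}. h (f x \<odot>\<^bsub>M\<^esub> v x))"
    unfolding lin_comb_def by (rule module_homs_finsum[OF assms(1-3)]) (use v D in auto)
  also have "\<dots> = lin_comb R N (\<lambda>x. h (v x)) f"
    unfolding lin_comb_def
    by (rule N.M.finsum_cong') (use v D assms(3) in \<open>auto simp: module_homs_def hom_def Pi_iff\<close>)
  finally show ?thesis .
qed

lemma free_gen_closed: "cring R \<Longrightarrow> x \<in> X \<Longrightarrow> free_gen R x \<in> carrier (free_module R X)"
proof -
  assume "cring R" "x \<in> X"
  then interpret cring R by simp
  have "{y. free_gen R x y \<noteq> \<zero>\<^bsub>R\<^esub>} \<subseteq> {x}" by (auto simp: free_gen_def)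
  then show ?thesis
    using \<open>x \<in> X\<close> finite_subset[of _ "{x}"] by (auto simp: free_module_def free_gen_def)
qed

theorem projective_lifting:
  fixes P :: "('a, 'u) module"
    and X :: "('a, 'x, 'xm) module_scheme" and Y :: "('a, 'y, 'ym) module_scheme"
  assumes P: "projective R P" and X: "module R X" and Y: "module R Y"
    and g: "g \<in> module_homs R X Y" and surj: "g ` carrier X = carrier Y"
    and f: "f \<in> module_homs R P Y"
  shows "\<exists>h \<in> module_homs R P X. \<forall>p \<in> carrier P. g (h p) = f p"
proof -
  have mP: "module R P" using P by (simp add: projective_def)
  interpret P: module R P by fact
  interpret X: module R X by fact
  interpret Y: module R Y by fact
  let ?F = "free_module R (carrier P)"
  let ?\<pi> = "lin_comb R P (\<lambda>p. p)"
  have mF: "module R ?F" by (rule free_module_is_module[OF P.R.is_cring])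
  have \<pi>: "?\<pi> \<in> module_homs R ?F P" by (rule P.lin_comb_hom)
  have "carrier P \<subseteq> ?\<pi> ` carrier ?F"
  proof
    fix p assume p: "p \<in> carrier P"
    have "?\<pi> (free_gen R p) = (\<Oplus>\<^bsub>P\<^esub> x \<in> {p}. free_gen R p x \<odot>\<^bsub>P\<^esub> x)"
      by (rule P.lin_comb_eq_finsum) (auto simp: free_gen_def p split: if_splits)
    also have "\<dots> = p" using p by (simp add: free_gen_def)
    finally have "p = ?\<pi> (free_gen R p)" by (rule sym)
    then show "p \<in> ?\<pi> ` carrier ?F"
      by (rule image_eqI[where x = "free_gen R p"]) (rule free_gen_closed[OF P.R.is_cring p])
  qed
  moreover have "?\<pi> ` carrier ?F \<subseteq> carrier P" using \<pi> by (auto simp: module_homs_def hom_def)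
  ultimately have \<pi>_surj: "?\<pi> ` carrier ?F = carrier P" by blast
  have "(\<lambda>p. p) \<in> module_homs R P P" by (auto simp: module_homs_def hom_def)
  note P[unfolded projective_def, THEN conjunct2, THEN spec[where x = ?F], THEN spec[where x = P],
      THEN spec[where x = ?\<pi>], THEN spec[where x = "\<lambda>p. p"],
      THEN mp[OF _ mF], THEN mp[OF _ mP], THEN mp[OF _ \<pi>], THEN mp[OF _ \<pi>_surj], THEN mp[OF _ this]]
  then obtain s where s: "s \<in> module_homs R P ?F"
    and \<pi>s: "\<And>p. p \<in> carrier P \<Longrightarrow> ?\<pi> (s p) = p"
    by blast
  have "\<forall>p \<in> carrier P. \<exists>x \<in> carrier X. g x = f p"
  proof
    fix p assume "p \<in> carrier P"
    then have "f p \<in> g ` carrier X" using surj f by (auto simp: module_homs_def hom_def)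
    then show "\<exists>x \<in> carrier X. g x = f p" by auto
  qed
  then obtain v where v: "\<And>p. p \<in> carrier P \<Longrightarrow> v p \<in> carrier X \<and> g (v p) = f p" by metis
  let ?\<phi> = "lin_comb R X v"
  have \<phi>: "?\<phi> \<in> module_homs R ?F X" by (rule X.lin_comb_hom) (use v in auto)
  have "(\<lambda>p. ?\<phi> (s p)) \<in> module_homs R P X"
    using s \<phi> by (auto simp: module_homs_def hom_def Pi_iff)
  moreover have "g (?\<phi> (s p)) = f p" if p: "p \<in> carrier P" for p
  proof -
    have sp: "s p \<in> carrier ?F" using s p by (auto simp: module_homs_def hom_def)
    note D = free_module_memD[OF P.R.is_cring sp]
    have fY: "f x \<in> carrier Y" if "x \<in> carrier P" for x
      using f that by (auto simp: module_homs_def hom_def)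
    have "g (?\<phi> (s p)) = lin_comb R Y (\<lambda>q. g (v q)) (s p)"
      using v by (intro module_homs_lin_comb[where X = "carrier P", OF X Y g _ sp]) simp
    moreover have "lin_comb R Y (\<lambda>q. g (v q)) (s p) = lin_comb R Y f (s p)"
      unfolding lin_comb_def
    proof (rule Y.M.finsum_cong'[OF refl])
      show "(\<lambda>x. s p x \<odot>\<^bsub>Y\<^esub> f x) \<in> {x. s p x \<noteq> \<zero>\<^bsub>R\<^esub>} \<rightarrow> carrier Y"
        by (rule funcsetI, rule Y.smult_closed, rule D(1), rule fY, rule subsetD[OF D(3)])
    next
      fix x assume "x \<in> {x. s p x \<noteq> \<zero>\<^bsub>R\<^esub>}"
      with D(3) have "x \<in> carrier P" by (rule subsetD)
      then have "g (v x) = f x" using v by blast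
      then show "s p x \<odot>\<^bsub>Y\<^esub> g (v x) = s p x \<odot>\<^bsub>Y\<^esub> f x" by (rule arg_cong)
    qed
    moreover have "lin_comb R Y f (s p) = f (?\<pi> (s p))"
      using module_homs_lin_comb[where v = "\<lambda>q. q" and X = "carrier P", OF mP Y f _ sp] by simp
    ultimately show ?thesis using \<pi>s[OF p] by simp
  qed
  ultimately show ?thesis by (intro bexI[of _ "\<lambda>p. ?\<phi> (s p)"] ballI)
qed

lemma quotient_module_is_module:
  assumes "module R M" "submodule H R M"
  shows "module R (quotient_module R M H)"
proof -
  interpret module R M by fact
  interpret H: submodule H R M by fact
  interpret H: abelian_subgroup H M
    by (rule abelian_subgroupI3) (use H.subgroup_axioms in \<open>auto simp: additive_subgroup_def M.abelian_group_axioms\<close>)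
  let ?Q = "quotient_module R M H"
  have rep: "\<exists>x \<in> carrier M. C = H +>\<^bsub>M\<^esub> x" if "C \<in> carrier ?Q" for C
    using that by (auto simp: quotient_module_def A_RCOSETS_def')
  have cos [simp]: "H +>\<^bsub>M\<^esub> x \<in> carrier ?Q" if "x \<in> carrier M" for x
    using that by (auto simp: quotient_module_def A_RCOSETS_def')
  have add [simp]: "(H +>\<^bsub>M\<^esub> x) \<oplus>\<^bsub>?Q\<^esub> (H +>\<^bsub>M\<^esub> y) = H +>\<^bsub>M\<^esub> (x \<oplus>\<^bsub>M\<^esub> y)"
    if "x \<in> carrier M" "y \<in> carrier M" for x y
    using that by (simp add: quotient_module_def H.a_rcos_sum)
  have smult [simp]: "a \<odot>\<^bsub>?Q\<^esub> (H +>\<^bsub>M\<^esub> x) = H +>\<^bsub>M\<^esub> (a \<odot>\<^bsub>M\<^esub> x)"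
    if a: "a \<in> carrier R" and x: "x \<in> carrier M" for a x
  proof -
    have "H +>\<^bsub>M\<^esub> (a \<odot>\<^bsub>M\<^esub> y) = H +>\<^bsub>M\<^esub> (a \<odot>\<^bsub>M\<^esub> x)" if y: "y \<in> H +>\<^bsub>M\<^esub> x" for y
    proof -
      obtain h where h: "h \<in> H" "y = h \<oplus>\<^bsub>M\<^esub> x" using y by (auto simp: a_r_coset_def')
      have "a \<odot>\<^bsub>M\<^esub> y = a \<odot>\<^bsub>M\<^esub> h \<oplus>\<^bsub>M\<^esub> a \<odot>\<^bsub>M\<^esub> x"
        using h a x H.a_Hcarr by (simp add: smult_r_distr)
      then have "a \<odot>\<^bsub>M\<^esub> y \<in> H +>\<^bsub>M\<^esub> (a \<odot>\<^bsub>M\<^esub> x)"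
        using H.smult_closed[OF a h(1)] by (auto simp: a_r_coset_def')
      then show ?thesis
        by (rule H.a_repr_independence'[symmetric]) (rule smult_closed[OF a x])
    qed
    then have "(\<Union>y \<in> H +>\<^bsub>M\<^esub> x. H +>\<^bsub>M\<^esub> (a \<odot>\<^bsub>M\<^esub> y))
        = (\<Union>y \<in> H +>\<^bsub>M\<^esub> x. H +>\<^bsub>M\<^esub> (a \<odot>\<^bsub>M\<^esub> x))"
      by (intro SUP_cong) simp_all
    moreover have "x \<in> H +>\<^bsub>M\<^esub> x" using x by (rule H.a_rcos_self)
    ultimately have "(\<Union>y \<in> H +>\<^bsub>M\<^esub> x. H +>\<^bsub>M\<^esub> (a \<odot>\<^bsub>M\<^esub> y)) = H +>\<^bsub>M\<^esub> (a \<odot>\<^bsub>M\<^esub> x)"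
      by (metis SUP_const empty_iff)
    then show ?thesis by (simp add: quotient_module_def)
  qed
  have zero: "\<zero>\<^bsub>?Q\<^esub> = H +>\<^bsub>M\<^esub> \<zero>\<^bsub>M\<^esub>"
    using H.a_subset by (simp add: quotient_module_def M.a_coset_add_zero)
  have grp: "abelian_group ?Q"
  proof (rule abelian_groupI)
    fix C D E assume C: "C \<in> carrier ?Q" and D: "D \<in> carrier ?Q" and E: "E \<in> carrier ?Q"
    obtain x y z where [simp]: "x \<in> carrier M" "y \<in> carrier M" "z \<in> carrier M"
      and [simp]: "C = H +>\<^bsub>M\<^esub> x" "D = H +>\<^bsub>M\<^esub> y" "E = H +>\<^bsub>M\<^esub> z"
      using rep[OF C] rep[OF D] rep[OF E] by blast
    show "(C \<oplus>\<^bsub>?Q\<^esub> D) \<oplus>\<^bsub>?Q\<^esub> E = C \<oplus>\<^bsub>?Q\<^esub> (D \<oplus>\<^bsub>?Q\<^esub> E)"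
      by (simp add: M.a_assoc)
  next
    fix C D assume C: "C \<in> carrier ?Q" and D: "D \<in> carrier ?Q"
    obtain x y where [simp]: "x \<in> carrier M" "y \<in> carrier M"
      and [simp]: "C = H +>\<^bsub>M\<^esub> x" "D = H +>\<^bsub>M\<^esub> y"
      using rep[OF C] rep[OF D] by blast
    show "C \<oplus>\<^bsub>?Q\<^esub> D \<in> carrier ?Q" by simp
    show "C \<oplus>\<^bsub>?Q\<^esub> D = D \<oplus>\<^bsub>?Q\<^esub> C" using M.a_comm[of x y] by simp
  next
    fix C assume C: "C \<in> carrier ?Q"
    obtain x where x: "x \<in> carrier M" and [simp]: "C = H +>\<^bsub>M\<^esub> x"
      using rep[OF C] by blast
    show "\<zero>\<^bsub>?Q\<^esub> \<oplus>\<^bsub>?Q\<^esub> C = C" using x by (simp add: zero)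
    show "\<exists>D \<in> carrier ?Q. D \<oplus>\<^bsub>?Q\<^esub> C = \<zero>\<^bsub>?Q\<^esub>"
      using x by (intro bexI[of _ "H +>\<^bsub>M\<^esub> (\<ominus>\<^bsub>M\<^esub> x)"]) (simp_all add: zero M.l_neg)
  next
    show "\<zero>\<^bsub>?Q\<^esub> \<in> carrier ?Q" by (simp add: zero)
  qed
  show ?thesis
  proof (rule moduleI)
    fix a b C D assume ab: "a \<in> carrier R" "b \<in> carrier R"
      and C: "C \<in> carrier ?Q" and D: "D \<in> carrier ?Q"
    obtain x y where [simp]: "x \<in> carrier M" "y \<in> carrier M"
      and [simp]: "C = H +>\<^bsub>M\<^esub> x" "D = H +>\<^bsub>M\<^esub> y"
      using rep[OF C] rep[OF D] by blast
    show "(a \<oplus>\<^bsub>R\<^esub> b) \<odot>\<^bsub>?Q\<^esub> C = a \<odot>\<^bsub>?Q\<^esub> C \<oplus>\<^bsub>?Q\<^esub> b \<odot>\<^bsub>?Q\<^esub> C"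
      and "a \<odot>\<^bsub>?Q\<^esub> (C \<oplus>\<^bsub>?Q\<^esub> D) = a \<odot>\<^bsub>?Q\<^esub> C \<oplus>\<^bsub>?Q\<^esub> a \<odot>\<^bsub>?Q\<^esub> D"
      and "(a \<otimes>\<^bsub>R\<^esub> b) \<odot>\<^bsub>?Q\<^esub> C = a \<odot>\<^bsub>?Q\<^esub> (b \<odot>\<^bsub>?Q\<^esub> C)"
      using ab by (simp_all add: smult_l_distr smult_r_distr smult_assoc1)
  next
    fix a C assume a: "a \<in> carrier R" and C: "C \<in> carrier ?Q"
    obtain x where x: "x \<in> carrier M" and [simp]: "C = H +>\<^bsub>M\<^esub> x"
      using rep[OF C] by blast
    show "a \<odot>\<^bsub>?Q\<^esub> C \<in> carrier ?Q" using a x by simp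
  next
    fix C assume C: "C \<in> carrier ?Q"
    obtain x where x: "x \<in> carrier M" and [simp]: "C = H +>\<^bsub>M\<^esub> x"
      using rep[OF C] by blast
    show "\<one>\<^bsub>R\<^esub> \<odot>\<^bsub>?Q\<^esub> C = C" using x by simp
  qed (use grp R.is_cring in simp_all)
qed

lemma submodule_span_is_submodule:
  assumes "module R M" "S \<subseteq> carrier M"
  shows "submodule (submodule_span R M S) R M"
proof -
  interpret module R M by fact
  have top: "carrier M \<in> {H. submodule H R M \<and> S \<subseteq> H}"
    using assms carrier_is_submodule by simp
  have zero: "\<zero>\<^bsub>M\<^esub> \<in> H" if "submodule H R M" for H
    using subgroup.one_closed[OF submodule.axioms(1)[OF that]] by simp
  show ?thesis
    unfolding submodule_span_def
  proof (rule submoduleI)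
    show "\<Inter>{H. submodule H R M \<and> S \<subseteq> H} \<subseteq> carrier M" using top by (rule Inter_lower)
  qed (simp_all add: zero submoduleE(3,4,5))
qed

theorem tensor_product_is_module:
  assumes "module R M" "module R N"
  shows "module R (tensor_product R M N)"
proof -
  interpret M: module R M by fact
  interpret N: module R N by fact
  let ?F = "free_module R (carrier M \<times> carrier N)"
  have F: "module R ?F" by (rule free_module_is_module[OF M.R.is_cring])
  interpret F: module R ?F by fact
  have "tensor_relations R M N \<subseteq> carrier ?F"
    unfolding tensor_relations_def Let_def
    by (auto intro!: F.M.minus_closed F.M.add.m_closed F.smult_closed free_gen_closed[OF M.R.is_cring])
  then show ?thesis
    unfolding tensor_product_def Let_def
    by (intro quotient_module_is_module F submodule_span_is_submodule)
qed

end

theory Submission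
  imports Defs
begin

text \<open>
  A symmetric presentation of a torsionless module \<open>M\<close> forces \<open>Ext\<^sup>1(M, P) = 0\<close> for projective \<open>P\<close>.
  If \<open>0 \<rightarrow> P\<^sub>1 \<rightarrow> P\<^sub>0 \<rightarrow> M \<otimes> N \<rightarrow> 0\<close> is a projective resolution, then every homomorphism
  \<open>M \<rightarrow> M \<otimes> N\<close> therefore lifts to \<open>P\<^sub>0\<close>; this applies to \<open>x \<mapsto> x \<otimes> g\<close> for a minimal generator \<open>g\<close>
  of \<open>N\<close>. Over the residue field \<open>k\<close>, the coefficient of \<open>g\<close> gives \<open>M \<otimes> N \<rightarrow> M \<otimes> k\<close>, and
  \<open>M \<rightarrow> P\<^sub>0 \<rightarrow> M \<otimes> k\<close> is the canonical surjection. As \<open>P\<^sub>0\<close> is projective, its map to \<open>M \<otimes> k\<close>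
  lifts to the free module \<open>F\<close> of a minimal presentation \<open>F \<rightarrow> M\<close>. The composite
  \<open>F \<rightarrow> M \<rightarrow> P\<^sub>0 \<rightarrow> F\<close> is the identity modulo the maximal ideal, hence injective, so \<open>M \<cong> F\<close> is free.
\<close>

section \<open>Local rings\<close>

lemma (in abelian_group) add_minus_cancel_left:
  assumes "x \<in> carrier G" "y \<in> carrier G"
  shows "x \<oplus> y \<ominus> x = y"
proof -
  have "x \<oplus> y \<ominus> x = y \<oplus> x \<oplus> \<ominus> x" using assms by (simp only: minus_eq a_comm[of x y])
  also have "\<dots> = y" using assms by (simp add: a_assoc r_neg)
  finally show ?thesis .
qed

text \<open>Zorn's lemma for the ideals that contain \<open>a\<close> and avoid
  \<open>\<one>\<close>: the principal ideal of a nonunit is one of them, and the union of a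
  nonempty chain still avoids \<open>\<one>\<close>. A maximal member of this family is maximal
  among all proper ideals.\<close>

lemma (in cring) nonunit_in_maximalideal:
  assumes a: "a \<in> carrier R - Units R"
  obtains I where "maximalideal I R" "a \<in> I"
proof -
  define \<A> where "\<A> = {I. ideal I R \<and> a \<in> I \<and> \<one> \<notin> I}"
  have "PIdl a \<in> \<A>"
  proof -
    have "\<one> \<notin> PIdl a"
    proof
      assume "\<one> \<in> PIdl a"
      then obtain x where "x \<in> carrier R" "\<one> = x \<otimes> a" by (auto simp: cgenideal_def)
      with a show False by (auto simp: Units_def m_comm)
    qed
    then show ?thesis using a by (simp add: \<A>_def cgenideal_ideal cgenideal_self)
  qed
  moreover have "\<Union>C \<in> \<A>" if C: "C \<noteq> {}" "subset.chain \<A> C" for C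
  proof -
    have "subset.chain {I. ideal I R} C" "C \<subseteq> \<A>"
      using C(2) by (auto simp: pred_on.chain_def \<A>_def)
    then show ?thesis using chain_Union_is_ideal[of C] C(1) by (auto simp: \<A>_def)
  qed
  ultimately obtain I where I: "I \<in> \<A>" and max: "\<And>J. J \<in> \<A> \<Longrightarrow> I \<subseteq> J \<Longrightarrow> J = I"
    using subset_Zorn_nonempty[of \<A>] by (metis empty_iff)
  have "maximalideal I R"
  proof (rule maximalidealI)
    show "ideal I R" "carrier R \<noteq> I" using I by (auto simp: \<A>_def)
  next
    fix J assume J: "ideal J R" "I \<subseteq> J" "J \<subseteq> carrier R"
    then have "J \<in> \<A>" if "\<one> \<notin> J" using I that by (auto simp: \<A>_def)
    with J max show "J = I \<or> J = carrier R" using ideal.one_imp_carrier by blast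
  qed
  with I that show thesis by (auto simp: \<A>_def)
qed

context local_ring
begin

abbreviation \<mm> where "\<mm> \<equiv> carrier R - Units R"

text \<open>The unique maximal ideal \<open>I\<close> contains no unit, and each nonunit lies in
  some maximal ideal, which has to be \<open>I\<close>. So \<open>I\<close> consists of exactly the
  nonunits.\<close>

lemma nonunits_ideal: "ideal \<mm> R"
proof -
  obtain I where I: "maximalideal I R" and uniq: "\<And>J. maximalideal J R \<Longrightarrow> J = I"
    using unique_maximal_ideal by blast
  interpret I: maximalideal I R by fact
  have "I \<subseteq> \<mm>"
  proof
    fix a assume a: "a \<in> I"
    then have "a \<in> carrier R" by (rule I.Icarr)
    moreover have "a \<notin> Units R"
    proof
      assume u: "a \<in> Units R"
      then have "inv a \<otimes> a \<in> I" using a by (intro I.I_l_closed) auto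
      with u have "\<one> \<in> I" by simp
      then show False using I.one_imp_carrier I.I_notcarr by simp
    qed
    ultimately show "a \<in> \<mm>" by simp
  qed
  moreover have "\<mm> \<subseteq> I" using uniq by (metis nonunit_in_maximalideal subsetI)
  ultimately show ?thesis using I.is_ideal by (simp add: subset_antisym)
qed

lemma nonunits_add_closed: "a \<in> \<mm> \<Longrightarrow> b \<in> \<mm> \<Longrightarrow> a \<oplus> b \<in> \<mm>"
  by (rule additive_subgroup.a_closed[OF ideal.axioms(1)[OF nonunits_ideal]])

lemma nonunits_mult_closed: "a \<in> \<mm> \<Longrightarrow> x \<in> carrier R \<Longrightarrow> x \<otimes> a \<in> \<mm>"
  by (rule ideal.I_l_closed[OF nonunits_ideal])

lemma zero_nonunit: "\<zero> \<in> \<mm>"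
  using additive_subgroup.zero_closed[OF ideal.axioms(1)[OF nonunits_ideal]] .

text \<open>Otherwise \<open>\<one>\<close> would be a sum of two nonunits, although these form an
  ideal.\<close>

lemma one_minus_nonunit:
  assumes "a \<in> \<mm>"
  shows "\<one> \<ominus> a \<in> Units R"
proof (rule ccontr)
  assume "\<one> \<ominus> a \<notin> Units R"
  then have "(\<one> \<ominus> a) \<oplus> a \<in> \<mm>" using assms by (intro nonunits_add_closed) auto
  moreover have "(\<one> \<ominus> a) \<oplus> a = \<one>" using assms by (simp add: minus_eq a_assoc l_neg)
  ultimately show False by simp
qed

text \<open>Gaussian elimination: the pivots \<open>1 - W s s\<close> are units, and the maximal ideal absorbs the
  correction terms.\<close>

lemma nonunit_matrix_fixed_vector:
  assumes "finite S" "\<And>i. i \<in> S \<Longrightarrow> z i \<in> carrier R"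
    and "\<And>i j. i \<in> S \<Longrightarrow> j \<in> S \<Longrightarrow> W i j \<in> \<mm>"
    and "\<And>i. i \<in> S \<Longrightarrow> z i = (\<Oplus>j\<in>S. W i j \<otimes> z j)"
  shows "i \<in> S \<Longrightarrow> z i = \<zero>"
  using assms
proof (induction S arbitrary: W i rule: finite_induct)
  case empty
  then show ?case by blast
next
  case (insert s S)
  define u where "u = inv (\<one> \<ominus> W s s)"
  have us: "\<one> \<ominus> W s s \<in> Units R" using insert.prems(3) by (intro one_minus_nonunit) simp
  have [simp]: "u \<in> carrier R" using us by (simp add: u_def)
  have [simp]: "z s \<in> carrier R" using insert.prems(2) by simp
  have zS [simp]: "z j \<in> carrier R" if "j \<in> S" for j using insert.prems(2) that by simp
  have W: "W i j \<in> \<mm>" if "i \<in> insert s S" "j \<in> insert s S" for i j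
    using insert.prems(3) that .
  have Wc [simp]: "W i j \<in> carrier R" if "i \<in> insert s S" "j \<in> insert s S" for i j
    using W[OF that] by simp
  have row: "z i = W i s \<otimes> z s \<oplus> (\<Oplus>j\<in>S. W i j \<otimes> z j)" if "i \<in> insert s S" for i
    using insert.prems(4)[OF that] insert.hyps that by (simp add: Pi_iff)
  let ?\<Sigma> = "\<Oplus>j\<in>S. W s j \<otimes> z j"
  have \<Sigma>: "?\<Sigma> \<in> carrier R" by (rule finsum_closed) auto
  have "(\<one> \<ominus> W s s) \<otimes> z s = z s \<ominus> W s s \<otimes> z s"
    by (simp add: minus_eq l_distr l_minus)
  also have "\<dots> = ?\<Sigma>"
  proof -
    have "z s \<ominus> W s s \<otimes> z s = (W s s \<otimes> z s \<oplus> ?\<Sigma>) \<ominus> W s s \<otimes> z s"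
      by (rule arg_cong[where f = "\<lambda>y. y \<ominus> W s s \<otimes> z s"]) (rule row, simp)
    also have "\<dots> = ?\<Sigma>"  by (rule add_minus_cancel_left) (use \<Sigma> in auto)
    finally show ?thesis .
  qed
  finally have "u \<otimes> ((\<one> \<ominus> W s s) \<otimes> z s) = u \<otimes> ?\<Sigma>" by simp
  moreover have "u \<otimes> ((\<one> \<ominus> W s s) \<otimes> z s) = z s"
    using us by (simp add: u_def m_assoc[symmetric])
  ultimately have zs: "z s = u \<otimes> ?\<Sigma>" by simp
  \<comment> \<open>Row \<open>s\<close> has expressed \<open>z s\<close> through the remaining
    unknowns. Substituting this into the other rows leaves a system on \<open>S\<close> whose matrix
    is the old one plus the correction \<open>(W i s \<otimes> u) \<otimes> W s j\<close>, again
    with nonunit entries.\<close>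
  have zero: "z i = \<zero>" if i: "i \<in> S" for i
  proof (rule insert.IH[OF i, where W = "\<lambda>i j. (W i s \<otimes> u) \<otimes> W s j \<oplus> W i j"])
    fix i j assume "i \<in> S" "j \<in> S"
    then show "(W i s \<otimes> u) \<otimes> W s j \<oplus> W i j \<in> \<mm>"
      by (intro nonunits_add_closed nonunits_mult_closed W) auto
  next
    fix i assume i: "i \<in> S"
    have "z i = W i s \<otimes> z s \<oplus> (\<Oplus>j\<in>S. W i j \<otimes> z j)" using i by (intro row) simp
    also have "W i s \<otimes> z s = (W i s \<otimes> u) \<otimes> ?\<Sigma>"
      unfolding zs using i by (intro m_assoc[symmetric] \<Sigma>) auto
    also have "(W i s \<otimes> u) \<otimes> ?\<Sigma> = (\<Oplus>j\<in>S. (W i s \<otimes> u) \<otimes> (W s j \<otimes> z j))"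
      using i insert.hyps by (intro finsum_rdistr) auto
    also have "\<dots> \<oplus> (\<Oplus>j\<in>S. W i j \<otimes> z j)
        = (\<Oplus>j\<in>S. (W i s \<otimes> u) \<otimes> (W s j \<otimes> z j) \<oplus> W i j \<otimes> z j)"
      by (rule finsum_addf[symmetric]) (simp_all add: Pi_iff i)
    also have "\<dots> = (\<Oplus>j\<in>S. ((W i s \<otimes> u) \<otimes> W s j \<oplus> W i j) \<otimes> z j)"
      using i by (intro finsum_cong') (auto simp: l_distr m_assoc)
    finally show "z i = (\<Oplus>j\<in>S. ((W i s \<otimes> u) \<otimes> W s j \<oplus> W i j) \<otimes> z j)" .
  qed simp
  have "?\<Sigma> = (\<Oplus>j\<in>S. \<zero>)" using zero by (intro finsum_cong') auto
  then have "z s = \<zero>" using zs by simp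
  with zero insert.prems(1) show ?case by blast
qed

text \<open>The equations \<open>zD\<close> say that \<open>z\<close> is fixed by the transpose of
  \<open>1 - D\<close>, a matrix with nonunit entries, so the elimination above applies. It stands
  in for the invertibility of the determinant of \<open>D\<close>.\<close>

lemma injective_if_identity_mod_nonunits:
  assumes fin: "finite S" and z: "\<And>i. i \<in> S \<Longrightarrow> z i \<in> carrier R"
    and D: "\<And>i j. i \<in> S \<Longrightarrow> j \<in> S \<Longrightarrow> D i j \<in> carrier R"
    and Dm: "\<And>i j. i \<in> S \<Longrightarrow> j \<in> S \<Longrightarrow> (if i = j then \<one> else \<zero>) \<ominus> D i j \<in> \<mm>"
    and zD: "\<And>j. j \<in> S \<Longrightarrow> (\<Oplus>i\<in>S. z i \<otimes> D i j) = \<zero>"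
    and i: "i \<in> S"
  shows "z i = \<zero>"
proof (rule nonunit_matrix_fixed_vector[OF fin, where W = "\<lambda>i j. (if j = i then \<one> else \<zero>) \<ominus> D j i"])
  fix j assume j: "j \<in> S"
  have zj: "z j = (\<Oplus>i\<in>S. if j = i then z i else \<zero>)"
    using add.finprod_singleton[OF j fin, of z] z by (simp add: Pi_iff)
  have "(\<Oplus>i\<in>S. ((if i = j then \<one> else \<zero>) \<ominus> D i j) \<otimes> z i) \<oplus> (\<Oplus>i\<in>S. z i \<otimes> D i j)
      = (\<Oplus>i\<in>S. ((if i = j then \<one> else \<zero>) \<ominus> D i j) \<otimes> z i \<oplus> z i \<otimes> D i j)"
    by (rule finsum_addf[symmetric]) (simp_all add: Pi_iff z D j)
  also have "\<dots> = (\<Oplus>i\<in>S. if j = i then z i else \<zero>)"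
  proof (intro finsum_cong' refl)
    fix i assume "i \<in> S"
    with z D j have "z i \<in> carrier R" "D i j \<in> carrier R" by auto
    then show "((if i = j then \<one> else \<zero>) \<ominus> D i j) \<otimes> z i \<oplus> z i \<otimes> D i j
        = (if j = i then z i else \<zero>)"
      by (simp add: minus_eq l_distr l_minus a_assoc l_neg m_comm[of "z i"])
  qed (use z in auto)
  finally show "z j = (\<Oplus>i\<in>S. ((if i = j then \<one> else \<zero>) \<ominus> D i j) \<otimes> z i)"
    using zj zD[OF j] z D j by (simp add: finsum_closed Pi_iff)
qed (use z Dm i in auto)

end

section \<open>Homomorphisms and free modules\<close>

lemma module_homsI:
  assumes "\<And>x. x \<in> carrier M \<Longrightarrow> h x \<in> carrier N"
    and "\<And>x y. x \<in> carrier M \<Longrightarrow> y \<in> carrier M \<Longrightarrow> h (x \<oplus>\<^bsub>M\<^esub> y) = h x \<oplus>\<^bsub>N\<^esub> h y"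
    and "\<And>a x. a \<in> carrier R \<Longrightarrow> x \<in> carrier M \<Longrightarrow> h (a \<odot>\<^bsub>M\<^esub> x) = a \<odot>\<^bsub>N\<^esub> h x"
  shows "h \<in> module_homs R M N"
  using assms by (auto simp: module_homs_def hom_def)

lemma module_homsD:
  assumes "h \<in> module_homs R M N"
  shows "x \<in> carrier M \<Longrightarrow> h x \<in> carrier N"
    and "x \<in> carrier M \<Longrightarrow> y \<in> carrier M \<Longrightarrow> h (x \<oplus>\<^bsub>M\<^esub> y) = h x \<oplus>\<^bsub>N\<^esub> h y"
    and "a \<in> carrier R \<Longrightarrow> x \<in> carrier M \<Longrightarrow> h (a \<odot>\<^bsub>M\<^esub> x) = a \<odot>\<^bsub>N\<^esub> h x"
  using assms by (auto simp: module_homs_def hom_def)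

lemma module_homs_zero:
  assumes "module R M" "module R N" "h \<in> module_homs R M N"
  shows "h \<zero>\<^bsub>M\<^esub> = \<zero>\<^bsub>N\<^esub>"
  using module_homs_finsum[OF assms, of "{}"] assms(1,2)
  by (simp add: module.axioms(2) abelian_group.axioms(1) abelian_monoid.finsum_empty)

lemma module_homs_comp:
  assumes "g \<in> module_homs R N L" "h \<in> module_homs R M N"
  shows "(\<lambda>x. g (h x)) \<in> module_homs R M L"
  using assms by (intro module_homsI) (simp_all add: module_homsD)

lemma module_homs_uminus:
  assumes M: "module R M" and N: "module R N" and h: "h \<in> module_homs R M N" and x: "x \<in> carrier M"
  shows "h (\<ominus>\<^bsub>M\<^esub> x) = \<ominus>\<^bsub>N\<^esub> h x"
proof -
  interpret M: module R M by fact
  interpret N: module R N by fact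
  have "h (\<ominus>\<^bsub>M\<^esub> x) \<oplus>\<^bsub>N\<^esub> h x = h (\<ominus>\<^bsub>M\<^esub> x \<oplus>\<^bsub>M\<^esub> x)" using x by (simp add: module_homsD(2)[OF h])
  also have "\<dots> = \<zero>\<^bsub>N\<^esub>" using x by (simp add: M.M.l_neg module_homs_zero[OF M N h])
  finally show ?thesis using x by (intro N.M.minus_equality[symmetric]) (auto simp: module_homsD(1)[OF h])
qed

lemma module_homs_minus:
  assumes M: "module R M" and N: "module R N" and h: "h \<in> module_homs R M N"
    and xy: "x \<in> carrier M" "y \<in> carrier M"
  shows "h (x \<ominus>\<^bsub>M\<^esub> y) = h x \<ominus>\<^bsub>N\<^esub> h y"
proof -
  interpret M: module R M by fact
  show ?thesis
    using xy by (simp add: a_minus_def module_homsD(2)[OF h] module_homs_uminus[OF M N h])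
qed

lemma module_homs_diff:
  assumes "module R M" "module R N" "g \<in> module_homs R M N" "h \<in> module_homs R M N"
  shows "(\<lambda>x. g x \<ominus>\<^bsub>N\<^esub> h x) \<in> module_homs R M N"
proof -
  interpret M: module R M by fact
  interpret N: module R N by fact
  note g = module_homsD[OF assms(3)] and h = module_homsD[OF assms(4)]
  show ?thesis
  proof (rule module_homsI)
    fix x y assume xy: "x \<in> carrier M" "y \<in> carrier M"
    show "g (x \<oplus>\<^bsub>M\<^esub> y) \<ominus>\<^bsub>N\<^esub> h (x \<oplus>\<^bsub>M\<^esub> y) = g x \<ominus>\<^bsub>N\<^esub> h x \<oplus>\<^bsub>N\<^esub> (g y \<ominus>\<^bsub>N\<^esub> h y)"
      using xy g(1) h(1) by (simp add: g(2) h(2) N.M.minus_eq N.M.minus_add N.M.a_ac)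
  next
    fix a x assume "a \<in> carrier R" "x \<in> carrier M"
    then show "g (a \<odot>\<^bsub>M\<^esub> x) \<ominus>\<^bsub>N\<^esub> h (a \<odot>\<^bsub>M\<^esub> x) = a \<odot>\<^bsub>N\<^esub> (g x \<ominus>\<^bsub>N\<^esub> h x)"
      using g(1) h(1) by (simp add: g(3) h(3) N.M.minus_eq N.smult_r_distr N.smult_r_minus)
  qed (simp add: g(1) h(1))
qed

lemma regular_module_is_module:
  assumes "cring R"
  shows "module R (regular_module R)"
proof -
  interpret cring R by fact
  have "abelian_group (regular_module R)"
    by (rule abelian_groupI) (auto simp: regular_module_def a_ac intro: l_neg)
  then show ?thesis
    by (intro moduleI) (auto simp: regular_module_def l_distr r_distr m_assoc is_cring)
qed

lemma regular_module_simps [simp]: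
  "carrier (regular_module R) = carrier R"
  "x \<oplus>\<^bsub>regular_module R\<^esub> y = x \<oplus>\<^bsub>R\<^esub> y"
  "a \<odot>\<^bsub>regular_module R\<^esub> x = a \<otimes>\<^bsub>R\<^esub> x"
  "\<zero>\<^bsub>regular_module R\<^esub> = \<zero>\<^bsub>R\<^esub>"
  "finsum (regular_module R) f S = finsum R f S"
  by (simp_all add: regular_module_def finsum_def finprod_def)

lemma regular_module_uminus [simp]: "\<ominus>\<^bsub>regular_module R\<^esub> x = \<ominus>\<^bsub>R\<^esub> x"
  by (simp add: a_inv_def m_inv_def regular_module_def)

lemma regular_module_minus [simp]: "x \<ominus>\<^bsub>regular_module R\<^esub> y = x \<ominus>\<^bsub>R\<^esub> y"
  by (simp add: a_minus_def)

lemma free_module_simps: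
  "f \<oplus>\<^bsub>free_module R X\<^esub> g = (\<lambda>x. f x \<oplus>\<^bsub>R\<^esub> g x)"
  "a \<odot>\<^bsub>free_module R X\<^esub> f = (\<lambda>x. a \<otimes>\<^bsub>R\<^esub> f x)"
  "\<zero>\<^bsub>free_module R X\<^esub> = (\<lambda>x. \<zero>\<^bsub>R\<^esub>)"
  by (simp_all add: free_module_def)

lemma free_module_eval_hom:
  assumes "cring R"
  shows "(\<lambda>f. f x) \<in> module_homs R (free_module R X) (regular_module R)"
  by (rule module_homsI) (simp_all add: free_module_simps free_module_memD(1)[OF assms])

lemma free_module_carrier_finite:
  assumes "finite X"
  shows "f \<in> carrier (free_module R X) \<longleftrightarrow>
    (\<forall>x\<in>X. f x \<in> carrier R) \<and> (\<forall>x. x \<notin> X \<longrightarrow> f x = \<zero>\<^bsub>R\<^esub>)"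
proof -
  have "finite {x. f x \<noteq> \<zero>\<^bsub>R\<^esub>}" if "\<forall>x. x \<notin> X \<longrightarrow> f x = \<zero>\<^bsub>R\<^esub>"
    using that by (intro finite_subset[OF _ assms]) auto
  then show ?thesis by (auto simp: free_module_def)
qed

context module
begin

lemma lin_comb_finite:
  assumes "finite X" "f \<in> carrier (free_module R X)" "\<And>x. x \<in> X \<Longrightarrow> v x \<in> carrier M"
  shows "lin_comb R M v f = (\<Oplus>\<^bsub>M\<^esub> x \<in> X. f x \<odot>\<^bsub>M\<^esub> v x)"
  using assms free_module_memD[OF R.is_cring assms(2)] by (intro lin_comb_eq_finsum) auto

lemma lin_comb_free_gen:
  assumes "v x \<in> carrier M"
  shows "lin_comb R M v (free_gen R x) = v x"
proof -
  have "lin_comb R M v (free_gen R x) = (\<Oplus>\<^bsub>M\<^esub> y \<in> {x}. free_gen R x y \<odot>\<^bsub>M\<^esub> v y)"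
    using assms by (intro lin_comb_eq_finsum) (auto simp: free_gen_def split: if_splits)
  then show ?thesis using assms by (simp add: free_gen_def)
qed

end

text \<open>Evaluation at \<open>y\<close> is linear, which reduces the claim to a sum in
  \<open>R\<close> whose only surviving term is \<open>f y\<close>.\<close>

lemma lin_comb_free_module:
  fixes X :: "'x set"
  assumes R: "cring R" and f: "f \<in> carrier (free_module R X)"
  shows "lin_comb R (free_module R X) (free_gen R) f = f"
proof
  interpret cring R by fact
  interpret F: module R "free_module R X" by (rule free_module_is_module[OF R])
  interpret A: module R "regular_module R" by (rule regular_module_is_module[OF R])
  note D = free_module_memD[OF R f]
  fix y
  have "lin_comb R (free_module R X) (free_gen R) f y
      = lin_comb R (regular_module R) (\<lambda>x. free_gen R x y) f"
    by (rule module_homs_lin_comb[OF F.module_axioms A.module_axioms free_module_eval_hom[OF R] _ f])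
      (rule free_gen_closed[OF R])
  \<comment> \<open>Adding \<open>y\<close> to the support lets the one-term sum formula also cover
    the case that \<open>f y\<close> is zero.\<close>
  also have "\<dots> = (\<Oplus>\<^bsub>R\<^esub>x \<in> insert y {x. f x \<noteq> \<zero>\<^bsub>R\<^esub>}. f x \<otimes>\<^bsub>R\<^esub> free_gen R x y)"
    using D by (subst A.lin_comb_eq_finsum[where S = "insert y {x. f x \<noteq> \<zero>\<^bsub>R\<^esub>}"]) (auto simp: free_gen_def)
  also have "\<dots> = (\<Oplus>\<^bsub>R\<^esub>x \<in> insert y {x. f x \<noteq> \<zero>\<^bsub>R\<^esub>}. if y = x then f x else \<zero>\<^bsub>R\<^esub>)"
    using D(1) by (intro finsum_cong') (auto simp: free_gen_def)
  also have "\<dots> = f y"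
    using D(1,2) by (intro add.finprod_singleton) auto
  finally show "lin_comb R (free_module R X) (free_gen R) f y = f y" .
qed

lemma module_homs_free_eq:
  assumes T: "module R T" and h: "h \<in> module_homs R (free_module R X) T"
    and f: "f \<in> carrier (free_module R X)"
  shows "h f = lin_comb R T (\<lambda>x. h (free_gen R x)) f"
proof -
  interpret T: module R T by fact
  have "h (lin_comb R (free_module R X) (free_gen R) f) = lin_comb R T (\<lambda>x. h (free_gen R x)) f"
    by (rule module_homs_lin_comb[OF free_module_is_module[OF T.R.is_cring] T h
          free_gen_closed[OF T.R.is_cring] f])
  then show ?thesis by (simp add: lin_comb_free_module[OF T.R.is_cring f])
qed

lemma lin_comb_cong:
  assumes T: "module R T" and f: "f \<in> carrier (free_module R X)"
    and v: "\<And>x. x \<in> X \<Longrightarrow> v x = w x" "\<And>x. x \<in> X \<Longrightarrow> w x \<in> carrier T"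
  shows "lin_comb R T v f = lin_comb R T w f"
proof -
  interpret T: module R T by fact
  note D = free_module_memD[OF T.R.is_cring f]
  show ?thesis unfolding lin_comb_def
    using D v by (intro T.M.finsum_cong') auto
qed

lemma module_homs_free_eqI:
  assumes T: "module R T" and g: "g \<in> module_homs R (free_module R X) T"
    and h: "h \<in> module_homs R (free_module R X) T"
    and eq: "\<And>x. x \<in> X \<Longrightarrow> g (free_gen R x) = h (free_gen R x)"
    and f: "f \<in> carrier (free_module R X)"
  shows "g f = h f"
proof -
  interpret T: module R T by fact
  show ?thesis
    unfolding module_homs_free_eq[OF T g f] module_homs_free_eq[OF T h f]
    by (intro lin_comb_cong[OF T f] eq module_homsD(1)[OF h] free_gen_closed[OF T.R.is_cring])
qed

section \<open>Submodules and generating sets\<close>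

lemma submodule_zero_closed:
  assumes "submodule H R M"
  shows "\<zero>\<^bsub>M\<^esub> \<in> H"
  using subgroup.one_closed[OF submodule.axioms(1)[OF assms]] by simp

lemma submodule_vimage:
  assumes M: "module R M" and N: "module R N" and h: "h \<in> module_homs R M N" and H: "submodule H R N"
  shows "submodule {x \<in> carrier M. h x \<in> H} R M"
proof -
  interpret M: module R M by fact
  interpret N: module R N by fact
  show ?thesis
    by (rule M.submoduleI)
      (auto simp: module_homsD[OF h] module_homs_zero[OF M N h] module_homs_uminus[OF M N h]
        submodule_zero_closed[OF H] N.submoduleE[OF H])
qed

lemma submodule_span_minimal: "submodule H R M \<Longrightarrow> S \<subseteq> H \<Longrightarrow> submodule_span R M S \<subseteq> H"
  by (auto simp: submodule_span_def)

lemma submodule_span_superset: "S \<subseteq> submodule_span R M S"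
  by (auto simp: submodule_span_def)

context module
begin

lemma submodule_finsum_closed:
  assumes H: "submodule H R M" and "finite S" "\<And>x. x \<in> S \<Longrightarrow> f x \<in> H"
  shows "(\<Oplus>\<^bsub>M\<^esub> x \<in> S. f x) \<in> H"
  using assms(2,3)
proof (induction S rule: finite_induct)
  case empty
  then show ?case by (simp add: submodule_zero_closed[OF H])
next
  case (insert s S)
  have "f \<in> S \<rightarrow> carrier M" "f s \<in> carrier M"
    using insert.prems submoduleE(1)[OF H] by auto
  with insert show ?case by (simp add: submoduleE(5)[OF H])
qed

lemma image_submodule:
  assumes K: "module R K" and h: "h \<in> module_homs R K M"
  shows "submodule (h ` carrier K) R M"
proof (rule submoduleI)
  interpret K: module R K by fact
  note D = module_homsD[OF h]
  show "h ` carrier K \<subseteq> carrier M" using D(1) by auto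
  show "\<zero>\<^bsub>M\<^esub> \<in> h ` carrier K"
    using module_homs_zero[OF K module_axioms h] K.M.zero_closed by (metis image_eqI)
  show "\<ominus>\<^bsub>M\<^esub> y \<in> h ` carrier K" if "y \<in> h ` carrier K" for y
    using that module_homs_uminus[OF K module_axioms h] K.M.a_inv_closed
    by (metis (no_types, lifting) imageE image_eqI)
  show "y \<oplus>\<^bsub>M\<^esub> z \<in> h ` carrier K" if "y \<in> h ` carrier K" "z \<in> h ` carrier K" for y z
    using that D(2) K.M.add.m_closed by (metis (no_types, lifting) imageE image_eqI)
  show "a \<odot>\<^bsub>M\<^esub> y \<in> h ` carrier K" if "a \<in> carrier R" "y \<in> h ` carrier K" for a y
    using that D(3) K.smult_closed by (metis (no_types, lifting) imageE image_eqI)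
qed

text \<open>The image is a submodule that contains each generator, as the image of its basis vector;
  hence it contains their span.\<close>

lemma lin_comb_surj_if_generating:
  assumes S: "S \<subseteq> carrier M" "submodule_span R M S = carrier M"
  shows "lin_comb R M (\<lambda>x. x) ` carrier (free_module R S) = carrier M"
proof -
  let ?\<pi> = "lin_comb R M (\<lambda>x. x)"
  have \<pi>: "?\<pi> \<in> module_homs R (free_module R S) M" using S by (intro lin_comb_hom) auto
  have sub: "submodule (?\<pi> ` carrier (free_module R S)) R M"
    by (rule image_submodule[OF free_module_is_module[OF R.is_cring] \<pi>])
  moreover have "S \<subseteq> ?\<pi> ` carrier (free_module R S)"
  proof
    fix s assume s: "s \<in> S"
    then have "?\<pi> (free_gen R s) = s" using S by (intro lin_comb_free_gen) auto
    then show "s \<in> ?\<pi> ` carrier (free_module R S)"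
      using free_gen_closed[OF R.is_cring s] by (metis image_eqI)
  qed
  ultimately have "carrier M \<subseteq> ?\<pi> ` carrier (free_module R S)"
    using submodule_span_minimal S by metis
  then show ?thesis using submoduleE(1)[OF sub] by blast
qed

end

section \<open>Minimal generating sets\<close>

text \<open>Take a generating set of least cardinality. A relation with a unit coefficient at
  \<open>b\<close> could be solved for \<open>b\<close>, and \<open>b\<close> could be dropped. So
  all coefficients of relations lie in the maximal ideal.\<close>

lemma (in module) minimal_generators:
  assumes loc: "local_ring R" and fg: "finitely_generated R M"
  obtains B where "finite B" "B \<subseteq> carrier M"
    "lin_comb R M (\<lambda>x. x) ` carrier (free_module R B) = carrier M"
    "\<And>z b. z \<in> carrier (free_module R B) \<Longrightarrow> lin_comb R M (\<lambda>x. x) z = \<zero>\<^bsub>M\<^esub> \<Longrightarrow> z b \<notin> Units R"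
proof -
  interpret local_ring R by fact
  define gen where "gen S \<longleftrightarrow> finite S \<and> S \<subseteq> carrier M \<and> submodule_span R M S = carrier M" for S
  obtain S where "gen S" using fg by (auto simp: finitely_generated_def gen_def)
  then obtain B where B: "gen B" and min: "\<And>S. gen S \<Longrightarrow> card B \<le> card S"
    using ex_has_least_nat[of gen S card] by metis
  have fin: "finite B" and sub: "B \<subseteq> carrier M" and span: "submodule_span R M B = carrier M"
    using B by (auto simp: gen_def)
  show thesis
  proof (rule that[OF fin sub lin_comb_surj_if_generating[OF sub span]])
    fix z b assume z: "z \<in> carrier (free_module R B)" and rel: "lin_comb R M (\<lambda>x. x) z = \<zero>\<^bsub>M\<^esub>"
    note D = free_module_memD[OF R.is_cring z]
    show "z b \<notin> Units R"
    proof
      assume u: "z b \<in> Units R"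
      \<comment> \<open>A coefficient outside \<open>B\<close> would be \<open>\<zero>\<close>, a
        nonunit; so \<open>b\<close> is one of the generators.\<close>
      then have "z b \<noteq> \<zero>" using zero_nonunit by auto
      then have b: "b \<in> B" using D(3) by auto
      let ?H = "submodule_span R M (B - {b})"
      have H: "submodule ?H R M" using sub by (intro submodule_span_is_submodule module_axioms) auto
      have BH: "B - {b} \<subseteq> ?H" by (rule submodule_span_superset)
      let ?s = "\<Oplus>\<^bsub>M\<^esub> x \<in> B - {b}. z x \<odot>\<^bsub>M\<^esub> x"
      have s: "?s \<in> ?H"
        using BH fin D(1) by (intro submodule_finsum_closed[OF H] submoduleE(4)[OF H]) auto
      then have sM: "?s \<in> carrier M" using submoduleE(1)[OF H] by auto
      have bM: "b \<in> carrier M" using b sub by auto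
      have "\<zero>\<^bsub>M\<^esub> = (\<Oplus>\<^bsub>M\<^esub> x \<in> insert b (B - {b}). z x \<odot>\<^bsub>M\<^esub> x)"
        using lin_comb_finite[OF fin z, of "\<lambda>x. x"] rel sub b by (simp add: insert_absorb subset_iff)
      also have "\<dots> = z b \<odot>\<^bsub>M\<^esub> b \<oplus>\<^bsub>M\<^esub> ?s"
        using fin sub bM D(1) by (intro M.finsum_insert) auto
      finally have "z b \<odot>\<^bsub>M\<^esub> b = \<ominus>\<^bsub>M\<^esub> ?s"
        using bM D(1) sM by (intro M.minus_equality[symmetric]) auto
      then have "z b \<odot>\<^bsub>M\<^esub> b \<in> ?H" using submoduleE(3)[OF H s] by simp
      then have "inv (z b) \<odot>\<^bsub>M\<^esub> (z b \<odot>\<^bsub>M\<^esub> b) \<in> ?H"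
        using u by (simp add: submoduleE(4)[OF H])
      moreover have "inv (z b) \<odot>\<^bsub>M\<^esub> (z b \<odot>\<^bsub>M\<^esub> b) = b"
        using u bM by (simp add: smult_assoc1[symmetric] Units_closed)
      ultimately have "B \<subseteq> ?H" using BH by auto
      then have "carrier M \<subseteq> ?H" using submodule_span_minimal[OF H] span by blast
      then have "gen (B - {b})" using fin sub submoduleE(1)[OF H] by (auto simp: gen_def)
      from min[OF this] show False using card_Diff1_less[OF fin b] by simp
    qed
  qed
qed

text \<open>Representatives in \<open>R\<close> of the values of a linear map from \<open>M\<close>
  to \<open>R/I\<close>. This makes maps into the residue field available without forming a quotient
  ring.\<close>

definition linear_modulo ::
    "('a, 'r) ring_scheme \<Rightarrow> 'a set \<Rightarrow> ('a, 'b, 'm) module_scheme \<Rightarrow> ('b \<Rightarrow> 'a) \<Rightarrow> bool"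
  where "linear_modulo R I M s \<longleftrightarrow> s \<in> carrier M \<rightarrow> carrier R \<and>
    (\<forall>x \<in> carrier M. \<forall>y \<in> carrier M. s (x \<oplus>\<^bsub>M\<^esub> y) \<ominus>\<^bsub>R\<^esub> (s x \<oplus>\<^bsub>R\<^esub> s y) \<in> I) \<and>
    (\<forall>a \<in> carrier R. \<forall>x \<in> carrier M. s (a \<odot>\<^bsub>M\<^esub> x) \<ominus>\<^bsub>R\<^esub> a \<otimes>\<^bsub>R\<^esub> s x \<in> I)"

text \<open>The coordinates are the coefficients of arbitrarily chosen expressions in terms of a minimal
  generating set; two choices differ by a relation, whose coefficients are nonunits.\<close>

lemma (in module) minimal_generators_coordinates:
  assumes loc: "local_ring R" and fg: "finitely_generated R M"
  obtains B coord where "finite B" "B \<subseteq> carrier M"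
    "lin_comb R M (\<lambda>x. x) ` carrier (free_module R B) = carrier M"
    "\<And>b. linear_modulo R (carrier R - Units R) M (coord b)"
    "\<And>b c. c \<in> B \<Longrightarrow> (if c = b then \<one> else \<zero>) \<ominus> coord b c \<in> carrier R - Units R"
proof -
  obtain B where fin: "finite B" and sub: "B \<subseteq> carrier M"
    and surj: "lin_comb R M (\<lambda>x. x) ` carrier (free_module R B) = carrier M"
    and min: "\<And>z b. z \<in> carrier (free_module R B) \<Longrightarrow> lin_comb R M (\<lambda>x. x) z = \<zero>\<^bsub>M\<^esub> \<Longrightarrow> z b \<notin> Units R"
    using minimal_generators[OF loc fg] by blast
  let ?F = "free_module R B" and ?\<pi> = "lin_comb R M (\<lambda>x. x)"
  have mF: "module R ?F" by (rule free_module_is_module[OF R.is_cring])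
  interpret F: module R ?F by fact
  have \<pi>: "?\<pi> \<in> module_homs R ?F M" using sub by (intro lin_comb_hom) auto
  have "\<forall>x \<in> carrier M. \<exists>f \<in> carrier ?F. ?\<pi> f = x" using surj by (metis imageE)
  then obtain rep where rep: "\<And>x. x \<in> carrier M \<Longrightarrow> rep x \<in> carrier ?F"
    "\<And>x. x \<in> carrier M \<Longrightarrow> ?\<pi> (rep x) = x"
    by metis
  note memD = free_module_memD(1)[OF R.is_cring, of _ B]
  have diff: "f b \<ominus> g b \<in> carrier R - Units R"
    if f: "f \<in> carrier ?F" and g: "g \<in> carrier ?F" and eq: "?\<pi> f = ?\<pi> g" for f g b
  proof -
    have "?\<pi> (f \<ominus>\<^bsub>?F\<^esub> g) = ?\<pi> f \<ominus>\<^bsub>M\<^esub> ?\<pi> g"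
      using f g by (simp add: F.M.minus_eq M.minus_eq module_homsD[OF \<pi>]
          module_homs_uminus[OF mF module_axioms \<pi>])
    also have "\<dots> = \<zero>\<^bsub>M\<^esub>" using module_homsD(1)[OF \<pi> g] by (simp add: eq M.minus_eq M.r_neg)
    finally have "(f \<ominus>\<^bsub>?F\<^esub> g) b \<notin> Units R" using f g by (intro min) auto
    moreover have "(f \<ominus>\<^bsub>?F\<^esub> g) b = f b \<ominus> g b"
      using f g module_homs_uminus[OF mF regular_module_is_module[OF R.is_cring]
          free_module_eval_hom[OF R.is_cring, of b] g]
      by (simp add: F.M.minus_eq free_module_simps R.minus_eq a_inv_def m_inv_def regular_module_def)
    ultimately show ?thesis using memD[OF f] memD[OF g] by simp
  qed
  show thesis
  proof (rule that[OF fin sub surj, of "\<lambda>b x. rep x b"])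
    fix b
    show "linear_modulo R (carrier R - Units R) M (\<lambda>x. rep x b)"
      unfolding linear_modulo_def
    proof (intro conjI ballI)
      show "(\<lambda>x. rep x b) \<in> carrier M \<rightarrow> carrier R" using memD[OF rep(1)] by auto
      show "rep (x \<oplus>\<^bsub>M\<^esub> y) b \<ominus> (rep x b \<oplus> rep y b) \<in> carrier R - Units R"
        if "x \<in> carrier M" "y \<in> carrier M" for x y
        using diff[of "rep (x \<oplus>\<^bsub>M\<^esub> y)" "rep x \<oplus>\<^bsub>?F\<^esub> rep y" b] that
        by (simp add: rep module_homsD[OF \<pi>]) (simp add: free_module_simps)
      show "rep (a \<odot>\<^bsub>M\<^esub> x) b \<ominus> a \<otimes> rep x b \<in> carrier R - Units R"
        if "a \<in> carrier R" "x \<in> carrier M" for a x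
        using diff[of "rep (a \<odot>\<^bsub>M\<^esub> x)" "a \<odot>\<^bsub>?F\<^esub> rep x" b] that
        by (simp add: rep module_homsD[OF \<pi>]) (simp add: free_module_simps)
    qed
  next
    fix b c assume c: "c \<in> B"
    then have "c \<in> carrier M" using sub by auto
    then have "?\<pi> (free_gen R c) = ?\<pi> (rep c)" by (simp add: lin_comb_free_gen rep)
    from diff[OF free_gen_closed[OF R.is_cring c] rep(1)[OF \<open>c \<in> carrier M\<close>] this, of b]
    show "(if c = b then \<one> else \<zero>) \<ominus> rep c b \<in> carrier R - Units R"
      by (simp add: free_gen_def eq_commute[of b])
  qed
qed

section \<open>Tensor products\<close>

context
  fixes R :: "('a, 'r) ring_scheme" and M :: "('a, 'b, 'm) module_scheme" and H
  assumes M: "module R M" and H: "submodule H R M"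
begin

interpretation module R M by (rule M)

lemma submodule_abelian_subgroup: "abelian_subgroup H M"
  using submodule.axioms(1)[OF H]
  by (intro abelian_subgroupI3) (auto simp: additive_subgroup_def M.abelian_group_axioms)

interpretation H: abelian_subgroup H M by (rule submodule_abelian_subgroup)

lemma quotient_proj_surj: "(\<lambda>x. H +>\<^bsub>M\<^esub> x) ` carrier M = carrier (quotient_module R M H)"
  by (auto simp: quotient_module_def A_RCOSETS_def')

lemma quotient_proj_eqI:
  assumes "x \<in> carrier M" "y \<in> carrier M" "x \<ominus>\<^bsub>M\<^esub> y \<in> H"
  shows "H +>\<^bsub>M\<^esub> x = H +>\<^bsub>M\<^esub> y"
proof -
  have "x = (x \<ominus>\<^bsub>M\<^esub> y) \<oplus>\<^bsub>M\<^esub> y" using assms by (simp add: M.minus_eq M.a_assoc M.l_neg)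
  then have "x \<in> H +>\<^bsub>M\<^esub> y" using assms(3) by (auto simp: a_r_coset_def')
  then show ?thesis using assms(2) by (rule H.a_repr_independence'[symmetric])
qed

lemma quotient_proj_eqD:
  assumes x: "x \<in> carrier M" and y: "y \<in> carrier M" and eq: "H +>\<^bsub>M\<^esub> x = H +>\<^bsub>M\<^esub> y"
  shows "x \<ominus>\<^bsub>M\<^esub> y \<in> H"
proof -
  have "x \<in> H +>\<^bsub>M\<^esub> y" using H.a_rcos_self[OF x] eq by simp
  then obtain h where h: "h \<in> H" "x = h \<oplus>\<^bsub>M\<^esub> y" by (auto simp: a_r_coset_def')
  then have "h \<in> carrier M" using H.a_Hcarr by blast
  with h y show ?thesis by (simp add: M.minus_eq M.a_assoc M.r_neg)
qed

lemma quotient_proj_hom: "(\<lambda>x. H +>\<^bsub>M\<^esub> x) \<in> module_homs R M (quotient_module R M H)"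
proof (rule module_homsI)
  show "H +>\<^bsub>M\<^esub> x \<in> carrier (quotient_module R M H)" if "x \<in> carrier M" for x
    using that quotient_proj_surj by blast
  show "H +>\<^bsub>M\<^esub> (x \<oplus>\<^bsub>M\<^esub> y) = (H +>\<^bsub>M\<^esub> x) \<oplus>\<^bsub>quotient_module R M H\<^esub> (H +>\<^bsub>M\<^esub> y)"
    if "x \<in> carrier M" "y \<in> carrier M" for x y
    using that by (simp add: quotient_module_def H.a_rcos_sum)
  show "H +>\<^bsub>M\<^esub> (a \<odot>\<^bsub>M\<^esub> x) = a \<odot>\<^bsub>quotient_module R M H\<^esub> (H +>\<^bsub>M\<^esub> x)"
    if a: "a \<in> carrier R" and x: "x \<in> carrier M" for a x
  proof -
    \<comment> \<open>Scalar multiplication on the quotient is a union over all representatives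
      \<open>y\<close>; it is a single coset because they all yield the same one.\<close>
    have "H +>\<^bsub>M\<^esub> (a \<odot>\<^bsub>M\<^esub> y) = H +>\<^bsub>M\<^esub> (a \<odot>\<^bsub>M\<^esub> x)" if y: "y \<in> H +>\<^bsub>M\<^esub> x" for y
    proof -
      obtain h where h: "h \<in> H" "y = h \<oplus>\<^bsub>M\<^esub> x" using y by (auto simp: a_r_coset_def')
      then have hM: "h \<in> carrier M" using H.a_Hcarr by blast
      have "a \<odot>\<^bsub>M\<^esub> y \<ominus>\<^bsub>M\<^esub> a \<odot>\<^bsub>M\<^esub> x = a \<odot>\<^bsub>M\<^esub> h"
        using h hM a x by (simp add: smult_r_distr M.minus_eq M.a_assoc M.r_neg)
      then show ?thesis
        using h hM a x submoduleE(4)[OF H a h(1)] by (intro quotient_proj_eqI) auto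
    qed
    moreover have "H +>\<^bsub>M\<^esub> x \<noteq> {}" using H.a_rcos_self[OF x] by blast
    ultimately have "(\<Union>y \<in> H +>\<^bsub>M\<^esub> x. H +>\<^bsub>M\<^esub> (a \<odot>\<^bsub>M\<^esub> y)) = H +>\<^bsub>M\<^esub> (a \<odot>\<^bsub>M\<^esub> x)"
      by (intro SUP_eq_const)
    then show ?thesis by (simp add: quotient_module_def)
  qed
qed

end

section \<open>Pure tensors and functionals on tensor products\<close>

lemma tensor_relations_closed:
  assumes "module R M" "module R N"
  shows "tensor_relations R M N \<subseteq> carrier (free_module R (carrier M \<times> carrier N))"
proof -
  interpret M: module R M by fact
  interpret N: module R N by fact
  interpret F: module R "free_module R (carrier M \<times> carrier N)"
    by (rule free_module_is_module[OF M.R.is_cring])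
  show ?thesis
    unfolding tensor_relations_def Let_def
    by (auto intro!: F.M.minus_closed F.M.add.m_closed F.smult_closed free_gen_closed[OF M.R.is_cring])
qed

abbreviation tensor_submodule where
  "tensor_submodule R M N \<equiv>
    submodule_span R (free_module R (carrier M \<times> carrier N)) (tensor_relations R M N)"

definition pure_tensor where
  "pure_tensor R M N x y =
    tensor_submodule R M N +>\<^bsub>free_module R (carrier M \<times> carrier N)\<^esub> free_gen R (x, y)"

lemma tensor_submodule:
  assumes "module R M" "module R N"
  shows "submodule (tensor_submodule R M N) R (free_module R (carrier M \<times> carrier N))"
  by (intro submodule_span_is_submodule free_module_is_module tensor_relations_closed assms
      module.axioms(1)[OF assms(1)])

text \<open>In the quotient, the first and third families of tensor relations become additivity and
  homogeneity in the left factor. For fixed \<open>y\<close> this is the map out of \<open>M\<close>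
  that will be lifted.\<close>

lemma pure_tensor_hom:
  assumes M: "module R M" and N: "module R N" and y: "y \<in> carrier N"
  shows "(\<lambda>x. pure_tensor R M N x y) \<in> module_homs R M (tensor_product R M N)"
proof -
  interpret M: module R M by fact
  interpret N: module R N by fact
  let ?F = "free_module R (carrier M \<times> carrier N)" and ?H = "tensor_submodule R M N"
  have F: "module R ?F" by (rule free_module_is_module[OF M.R.is_cring])
  interpret F: module R ?F by fact
  note H = tensor_submodule[OF M N]
  note \<pi> = quotient_proj_hom[OF F H]
  have rel: "u \<in> ?H" if "u \<in> tensor_relations R M N" for u
    using that by (rule subsetD[OF submodule_span_superset])
  have gen: "free_gen R (x, y) \<in> carrier ?F" if "x \<in> carrier M" for x
    using that y by (intro free_gen_closed[OF M.R.is_cring]) auto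
  show ?thesis
  proof (rule module_homsI)
    show "pure_tensor R M N x y \<in> carrier (tensor_product R M N)" if "x \<in> carrier M" for x
      using module_homsD(1)[OF \<pi> gen[OF that]] by (simp add: pure_tensor_def tensor_product_def Let_def)
  next
    fix x x' assume x: "x \<in> carrier M" "x' \<in> carrier M"
    have "free_gen R (x \<oplus>\<^bsub>M\<^esub> x', y) \<ominus>\<^bsub>?F\<^esub> (free_gen R (x, y) \<oplus>\<^bsub>?F\<^esub> free_gen R (x', y)) \<in> ?H"
      using x y by (intro rel, unfold tensor_relations_def Let_def) blast
    then have "?H +>\<^bsub>?F\<^esub> free_gen R (x \<oplus>\<^bsub>M\<^esub> x', y)
        = ?H +>\<^bsub>?F\<^esub> (free_gen R (x, y) \<oplus>\<^bsub>?F\<^esub> free_gen R (x', y))"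
      using x gen by (intro quotient_proj_eqI[OF F H]) auto
    then show "pure_tensor R M N (x \<oplus>\<^bsub>M\<^esub> x') y
        = pure_tensor R M N x y \<oplus>\<^bsub>tensor_product R M N\<^esub> pure_tensor R M N x' y"
      using module_homsD(2)[OF \<pi> gen gen] x by (simp add: pure_tensor_def tensor_product_def Let_def)
  next
    fix a x assume x: "a \<in> carrier R" "x \<in> carrier M"
    have "free_gen R (a \<odot>\<^bsub>M\<^esub> x, y) \<ominus>\<^bsub>?F\<^esub> a \<odot>\<^bsub>?F\<^esub> free_gen R (x, y) \<in> ?H"
      using x y by (intro rel, unfold tensor_relations_def Let_def) blast
    then have "?H +>\<^bsub>?F\<^esub> free_gen R (a \<odot>\<^bsub>M\<^esub> x, y) = ?H +>\<^bsub>?F\<^esub> (a \<odot>\<^bsub>?F\<^esub> free_gen R (x, y))"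
      using x gen by (intro quotient_proj_eqI[OF F H]) auto
    then show "pure_tensor R M N (a \<odot>\<^bsub>M\<^esub> x) y
        = a \<odot>\<^bsub>tensor_product R M N\<^esub> pure_tensor R M N x y"
      using module_homsD(3)[OF \<pi> _ gen] x by (simp add: pure_tensor_def tensor_product_def Let_def)
  qed
qed

lemma ideal_submodule_regular:
  assumes "cring R" "ideal I R"
  shows "submodule I R (regular_module R)"
proof -
  interpret ideal I R by fact
  interpret A: module R "regular_module R" by (rule regular_module_is_module[OF assms(1)])
  show ?thesis
    by (intro A.submoduleI) (auto intro: I_l_closed a_closed a_inv_closed simp: a_subset)
qed

text \<open>The product of \<open>s x\<close> and \<open>t y\<close> is bilinear modulo
  \<open>I\<close>, so its linear extension to the free module on pairs sends the tensor relations
  into \<open>I\<close>. Thus \<open>l\<close> represents a map from the tensor product to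
  \<open>R/I\<close>.\<close>

lemma tensor_functional:
  assumes M: "module R M" and N: "module R N" and I: "ideal I R"
    and s: "linear_modulo R I M s" and t: "linear_modulo R I N t"
  obtains l where
    "l \<in> module_homs R (free_module R (carrier M \<times> carrier N)) (regular_module R)"
    "\<And>x y. x \<in> carrier M \<Longrightarrow> y \<in> carrier N \<Longrightarrow> l (free_gen R (x, y)) = s x \<otimes>\<^bsub>R\<^esub> t y"
    "\<And>u. u \<in> tensor_submodule R M N \<Longrightarrow> l u \<in> I"
proof -
  interpret M: module R M by fact
  interpret N: module R N by fact
  let ?F = "free_module R (carrier M \<times> carrier N)" and ?A = "regular_module R"
  have F: "module R ?F" by (rule free_module_is_module[OF M.R.is_cring])
  interpret F: module R ?F by fact
  have A: "module R ?A" by (rule regular_module_is_module[OF M.R.is_cring])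
  interpret A: module R ?A by fact
  have absorb: "a \<otimes>\<^bsub>R\<^esub> b \<in> I" "b \<otimes>\<^bsub>R\<^esub> a \<in> I" if "a \<in> carrier R" "b \<in> I" for a b
    using ideal.I_l_closed[OF I that(2,1)] ideal.I_r_closed[OF I that(2,1)] by auto
  define l where "l = lin_comb R ?A (\<lambda>(x, y). s x \<otimes>\<^bsub>R\<^esub> t y)"
  have sR: "s x \<in> carrier R" if "x \<in> carrier M" for x
    using s that by (auto simp: linear_modulo_def)
  have tR: "t y \<in> carrier R" if "y \<in> carrier N" for y
    using t that by (auto simp: linear_modulo_def)
  have l: "l \<in> module_homs R ?F ?A"
    unfolding l_def by (rule A.lin_comb_hom) (auto simp: sR tR)
  have lgen: "l (free_gen R (x, y)) = s x \<otimes>\<^bsub>R\<^esub> t y" if "x \<in> carrier M" "y \<in> carrier N" for x y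
    unfolding l_def using that sR tR by (subst A.lin_comb_free_gen) auto
  have gen: "free_gen R (x, y) \<in> carrier ?F" if "x \<in> carrier M" "y \<in> carrier N" for x y
    using that by (intro free_gen_closed[OF M.R.is_cring]) auto
  have lminus: "l (u \<ominus>\<^bsub>?F\<^esub> w) = l u \<ominus>\<^bsub>R\<^esub> l w" if "u \<in> carrier ?F" "w \<in> carrier ?F" for u w
    using that by (simp add: module_homs_minus[OF F A l])
  \<comment> \<open>On each of the four families \<open>l u\<close> is a scalar times a linearity
    defect of \<open>s\<close> or \<open>t\<close>, and the defect lies in \<open>I\<close>.\<close>
  have "l u \<in> I" if "u \<in> tensor_relations R M N" for u
  proof -
    from that show ?thesis
      unfolding tensor_relations_def Let_def
    proof (elim UnE CollectE exE conjE)
      fix x x' y assume u: "u = free_gen R (x \<oplus>\<^bsub>M\<^esub> x', y) \<ominus>\<^bsub>?F\<^esub> (free_gen R (x, y) \<oplus>\<^bsub>?F\<^esub> free_gen R (x', y))"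
        and 1: "x \<in> carrier M" "x' \<in> carrier M" "y \<in> carrier N"
      note c = sR[OF 1(1)] sR[OF 1(2)] tR[OF 1(3)] sR[of "x \<oplus>\<^bsub>M\<^esub> x'"]
      have "l u = (s (x \<oplus>\<^bsub>M\<^esub> x') \<ominus>\<^bsub>R\<^esub> (s x \<oplus>\<^bsub>R\<^esub> s x')) \<otimes>\<^bsub>R\<^esub> t y"
        using 1 c unfolding u
        by (simp add: lminus gen module_homsD(2)[OF l] lgen)
          (simp add: M.R.minus_eq M.R.l_distr M.R.minus_add M.R.l_minus)
      moreover have "s (x \<oplus>\<^bsub>M\<^esub> x') \<ominus>\<^bsub>R\<^esub> (s x \<oplus>\<^bsub>R\<^esub> s x') \<in> I"
        using s 1 by (simp add: linear_modulo_def)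
      ultimately show "l u \<in> I" using absorb(2) c by simp
    next
      fix x y y' assume u: "u = free_gen R (x, y \<oplus>\<^bsub>N\<^esub> y') \<ominus>\<^bsub>?F\<^esub> (free_gen R (x, y) \<oplus>\<^bsub>?F\<^esub> free_gen R (x, y'))"
        and 2: "x \<in> carrier M" "y \<in> carrier N" "y' \<in> carrier N"
      note c = sR[OF 2(1)] tR[OF 2(2)] tR[OF 2(3)] tR[of "y \<oplus>\<^bsub>N\<^esub> y'"]
      have "l u = s x \<otimes>\<^bsub>R\<^esub> (t (y \<oplus>\<^bsub>N\<^esub> y') \<ominus>\<^bsub>R\<^esub> (t y \<oplus>\<^bsub>R\<^esub> t y'))"
        using 2 c unfolding u
        by (simp add: lminus gen module_homsD(2)[OF l] lgen)
          (simp add: M.R.minus_eq M.R.r_distr M.R.minus_add M.R.r_minus)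
      moreover have "t (y \<oplus>\<^bsub>N\<^esub> y') \<ominus>\<^bsub>R\<^esub> (t y \<oplus>\<^bsub>R\<^esub> t y') \<in> I"
        using t 2 by (simp add: linear_modulo_def)
      ultimately show "l u \<in> I" using absorb(1) c by simp
    next
      fix a x y assume u: "u = free_gen R (a \<odot>\<^bsub>M\<^esub> x, y) \<ominus>\<^bsub>?F\<^esub> (a \<odot>\<^bsub>?F\<^esub> free_gen R (x, y))"
        and 3: "a \<in> carrier R" "x \<in> carrier M" "y \<in> carrier N"
      note c = 3(1) sR[OF 3(2)] tR[OF 3(3)] sR[of "a \<odot>\<^bsub>M\<^esub> x"]
      have "l u = (s (a \<odot>\<^bsub>M\<^esub> x) \<ominus>\<^bsub>R\<^esub> a \<otimes>\<^bsub>R\<^esub> s x) \<otimes>\<^bsub>R\<^esub> t y"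
        using 3 c unfolding u
        by (simp add: lminus gen module_homsD(3)[OF l] lgen)
          (simp add: M.R.minus_eq M.R.l_distr M.R.l_minus M.R.m_assoc)
      moreover have "s (a \<odot>\<^bsub>M\<^esub> x) \<ominus>\<^bsub>R\<^esub> a \<otimes>\<^bsub>R\<^esub> s x \<in> I"
        using s 3 by (simp add: linear_modulo_def)
      ultimately show "l u \<in> I" using absorb(2) c by simp
    next
      fix a x y assume u: "u = free_gen R (x, a \<odot>\<^bsub>N\<^esub> y) \<ominus>\<^bsub>?F\<^esub> (a \<odot>\<^bsub>?F\<^esub> free_gen R (x, y))"
        and 4: "a \<in> carrier R" "x \<in> carrier M" "y \<in> carrier N"
      note c = 4(1) sR[OF 4(2)] tR[OF 4(3)] tR[of "a \<odot>\<^bsub>N\<^esub> y"]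
      have "l u = s x \<otimes>\<^bsub>R\<^esub> (t (a \<odot>\<^bsub>N\<^esub> y) \<ominus>\<^bsub>R\<^esub> a \<otimes>\<^bsub>R\<^esub> t y)"
        using 4 c unfolding u
        by (simp add: lminus gen module_homsD(3)[OF l] lgen)
          (simp add: M.R.minus_eq M.R.r_distr M.R.r_minus M.R.m_lcomm)
      moreover have "t (a \<odot>\<^bsub>N\<^esub> y) \<ominus>\<^bsub>R\<^esub> a \<otimes>\<^bsub>R\<^esub> t y \<in> I"
        using t 4 by (simp add: linear_modulo_def)
      ultimately show "l u \<in> I" using absorb(1) c by simp
    qed
  qed
  \<comment> \<open>The preimage of \<open>I\<close> under \<open>l\<close> is a submodule; as it
    contains the relations, it contains their span.\<close>
  then have "tensor_submodule R M N \<subseteq> {u \<in> carrier ?F. l u \<in> I}"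
    using tensor_relations_closed[OF M N]
    by (intro submodule_span_minimal submodule_vimage[OF F A l]
        ideal_submodule_regular[OF M.R.is_cring I]) auto
  then have "l u \<in> I" if "u \<in> tensor_submodule R M N" for u
    using that by blast
  with l lgen show thesis by (rule that)
qed

text \<open>If \<open>x \<mapsto> x \<otimes> g\<close> lifts to a projective module \<open>P\<close> over \<open>M \<otimes> N\<close>, for \<open>g\<close> in a minimal
  generating set of \<open>N\<close>, then composing the lift with lifts \<open>P \<rightarrow> R\<close> of the functionals
  \<open>M \<otimes> N \<rightarrow> R / \<mm>\<close> given by the coordinates recovers the coordinates on \<open>M\<close> modulo \<open>\<mm>\<close>.\<close>

lemma (in local_ring) free_if_tensor_lifts:
  fixes P :: "('a, 'u) module"
  assumes M: "module R M" and fgM: "finitely_generated R M"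
    and N: "module R N" and fgN: "finitely_generated R N" and N0: "carrier N \<noteq> {\<zero>\<^bsub>N\<^esub>}"
    and P: "projective R P" and e: "e \<in> module_homs R P (tensor_product R M N)"
    and lifts: "\<And>\<tau>. \<tau> \<in> module_homs R M (tensor_product R M N) \<Longrightarrow>
      \<exists>\<mu> \<in> module_homs R M P. \<forall>x \<in> carrier M. e (\<mu> x) = \<tau> x"
  shows "is_free R M"
proof -
  note loc = local_ring_axioms
  interpret M: module R M by fact
  interpret N: module R N by fact
  let ?F = "free_module R (carrier M \<times> carrier N)" and ?H = "tensor_submodule R M N"
  let ?A = "regular_module R"
  have F: "module R ?F" by (rule free_module_is_module[OF is_cring])
  interpret F: module R ?F by fact
  have A: "module R ?A" by (rule regular_module_is_module[OF is_cring])
  note H = tensor_submodule[OF M N]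
  have T: "module R (tensor_product R M N)" by (rule tensor_product_is_module[OF M N])
  have mP: "module R P" using P by (simp add: projective_def)
  obtain B coord where B: "finite B" "B \<subseteq> carrier M"
    and surjB: "lin_comb R M (\<lambda>x. x) ` carrier (free_module R B) = carrier M"
    and linB: "\<And>b. linear_modulo R \<mm> M (coord b)"
    and unitB: "\<And>b c. c \<in> B \<Longrightarrow> (if c = b then \<one> else \<zero>) \<ominus> coord b c \<in> \<mm>"
    using M.minimal_generators_coordinates[OF loc fgM] by metis
  obtain C coordN where C: "C \<subseteq> carrier N"
    and surjC: "lin_comb R N (\<lambda>x. x) ` carrier (free_module R C) = carrier N"
    and linC: "\<And>b. linear_modulo R \<mm> N (coordN b)"
    and unitC: "\<And>b c. c \<in> C \<Longrightarrow> (if c = b then \<one> else \<zero>) \<ominus> coordN b c \<in> \<mm>"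
    using N.minimal_generators_coordinates[OF loc fgN] by metis
  \<comment> \<open>An empty generating set would make \<open>N\<close> zero; this is where nonzero
    \<open>N\<close> supplies the generator \<open>g\<close>.\<close>
  have "C \<noteq> {}"
  proof
    assume "C = {}"
    then have "lin_comb R N (\<lambda>x. x) f = \<zero>\<^bsub>N\<^esub>" if "f \<in> carrier (free_module R C)" for f
      using N.lin_comb_finite[of C f "\<lambda>x. x"] that by simp
    then have "carrier N \<subseteq> {\<zero>\<^bsub>N\<^esub>}" using surjC by auto
    with N0 show False using N.M.zero_closed by blast
  qed
  then obtain g where g: "g \<in> C" by blast
  then have gN: "g \<in> carrier N" using C by auto
  obtain \<mu> where \<mu>: "\<mu> \<in> module_homs R M P"
    and e\<mu>: "\<And>x. x \<in> carrier M \<Longrightarrow> e (\<mu> x) = pure_tensor R M N x g"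
    using lifts[OF pure_tensor_hom[OF M N gN]] by blast
  have proj: "(\<lambda>u. ?H +>\<^bsub>?F\<^esub> u) \<in> module_homs R ?F (tensor_product R M N)"
    using quotient_proj_hom[OF F H] by (simp add: tensor_product_def Let_def)
  have projs: "(\<lambda>u. ?H +>\<^bsub>?F\<^esub> u) ` carrier ?F = carrier (tensor_product R M N)"
    using quotient_proj_surj[OF F H] by (simp add: tensor_product_def Let_def)
  \<comment> \<open>Projectivity lifts \<open>e\<close> to the free module on pairs once for all
    coordinates: composing \<open>h\<close> with the functionals \<open>l b\<close> below gives the
    lifts from the residue field to \<open>R\<close>.\<close>
  obtain h where h: "h \<in> module_homs R P ?F"
    and \<pi>h: "\<And>q. q \<in> carrier P \<Longrightarrow> ?H +>\<^bsub>?F\<^esub> h q = e q"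
    using projective_lifting[OF P F T proj projs e] by blast
  have gen: "free_gen R (x, g) \<in> carrier ?F" if "x \<in> carrier M" for x
    using that gN by (intro free_gen_closed[OF is_cring]) auto
  \<comment> \<open>Both elements represent the tensor of \<open>x\<close> and
    \<open>g\<close>.\<close>
  have h\<mu>: "h (\<mu> x) \<ominus>\<^bsub>?F\<^esub> free_gen R (x, g) \<in> ?H" if x: "x \<in> carrier M" for x
    using module_homsD(1)[OF \<mu> x] x gen e\<mu>[OF x] \<pi>h[of "\<mu> x"] module_homsD(1)[OF h]
    by (intro quotient_proj_eqD[OF F H]) (auto simp: pure_tensor_def)
  \<comment> \<open>These functionals pair the \<open>b\<close>-th coordinate on \<open>M\<close>
    with the \<open>g\<close>-th coordinate on \<open>N\<close>.\<close>
  have "\<forall>b. \<exists>l. l \<in> module_homs R ?F ?A \<and>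
      (\<forall>x \<in> carrier M. l (free_gen R (x, g)) = coord b x \<otimes> coordN g g) \<and> (\<forall>u \<in> ?H. l u \<in> \<mm>)"
    using gN by (metis tensor_functional[OF M N nonunits_ideal linB linC])
  then obtain l where l: "\<And>b. l b \<in> module_homs R ?F ?A"
    and lgen: "\<And>b x. x \<in> carrier M \<Longrightarrow> l b (free_gen R (x, g)) = coord b x \<otimes> coordN g g"
    and lH: "\<And>b u. u \<in> ?H \<Longrightarrow> l b u \<in> \<mm>"
    by metis
  \<comment> \<open>For \<open>b\<close> and \<open>c\<close> in \<open>B\<close>, the values
    \<open>D b c\<close> form the matrix of the endomorphism of the free module on \<open>B\<close>
    that passes through \<open>M\<close> and \<open>P\<close>.\<close>
  define D where "D b x = l b (h (\<mu> x))" for b x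
  have D: "D b \<in> module_homs R M ?A" for b
    unfolding D_def by (rule module_homs_comp[OF l module_homs_comp[OF h \<mu>]])
  \<comment> \<open>Modulo the maximal ideal, \<open>D b c\<close> is \<open>coord b c\<close> times
    \<open>coordN g g\<close>, the second factor is \<open>\<one>\<close>, and
    \<open>coord b c\<close> is the Kronecker delta. The identity below splits the difference into
    one term for each of these three congruences.\<close>
  have near: "(if c = b then \<one> else \<zero>) \<ominus> D b c \<in> \<mm>" if c: "c \<in> B" for b c
  proof -
    have cM: "c \<in> carrier M" using c B by auto
    have hc: "h (\<mu> c) \<in> carrier ?F" using cM module_homsD(1)[OF h] module_homsD(1)[OF \<mu>] by simp
    have coordR: "coord b c \<in> carrier R" "coordN g g \<in> carrier R"
      using linB[of b] linC[of g] cM gN by (auto simp: linear_modulo_def)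
    have DR: "D b c \<in> carrier R" using module_homsD(1)[OF D cM, of b] by simp
    let ?\<delta> = "if c = b then \<one> else \<zero>"
    have 1: "D b c \<ominus> coord b c \<otimes> coordN g g \<in> \<mm>"
    proof -
      have "l b (h (\<mu> c) \<ominus>\<^bsub>?F\<^esub> free_gen R (c, g)) = D b c \<ominus> coord b c \<otimes> coordN g g"
        using hc gen[OF cM] lgen[OF cM, of b]
        by (simp add: module_homs_minus[OF F A l] D_def)
      with lH[OF h\<mu>[OF cM], of b] show ?thesis by simp
    qed
    have 2: "coord b c \<otimes> (\<one> \<ominus> coordN g g) \<in> \<mm>"
      using unitC[OF g, of g] coordR by (intro nonunits_mult_closed) auto
    have m1: "\<ominus> \<one> \<in> carrier R" by simp
    have "?\<delta> \<ominus> D b c = (?\<delta> \<ominus> coord b c) \<oplus> (coord b c \<otimes> (\<one> \<ominus> coordN g g)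
        \<oplus> (\<ominus> \<one>) \<otimes> (D b c \<ominus> coord b c \<otimes> coordN g g))"
    proof -
      have \<delta>R: "?\<delta> \<in> carrier R" by simp
      define d where "d = ?\<delta>"
      have "d \<in> carrier R" using \<delta>R by (simp add: d_def)
      then have "d \<ominus> D b c = (d \<ominus> coord b c) \<oplus> (coord b c \<otimes> (\<one> \<ominus> coordN g g)
        \<oplus> (\<ominus> \<one>) \<otimes> (D b c \<ominus> coord b c \<otimes> coordN g g))"
        using coordR DR by algebra
      then show ?thesis by (simp only: d_def)
    qed
    then show ?thesis
      using unitB[OF c, of b] 1 2 m1 nonunits_add_closed nonunits_mult_closed by presburger
  qed
  let ?\<pi> = "lin_comb R M (\<lambda>x. x)" and ?E = "free_module R B"
  have E: "module R ?E" by (rule free_module_is_module[OF is_cring])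
  interpret E: module R ?E by fact
  have \<pi>: "?\<pi> \<in> module_homs R ?E M" using B by (intro M.lin_comb_hom) auto
  \<comment> \<open>Each \<open>D j\<close> is a functional on \<open>M\<close> and therefore
    annihilates a relation \<open>z\<close> among the generators. The resulting linear system has a
    matrix that is the identity modulo the maximal ideal, so \<open>z\<close> vanishes.\<close>
  have ker: "z = \<zero>\<^bsub>?E\<^esub>" if z: "z \<in> carrier ?E" and z0: "?\<pi> z = \<zero>\<^bsub>M\<^esub>" for z
  proof
    fix b
    note zD = free_module_memD[OF is_cring z]
    have rel: "(\<Oplus>i\<in>B. z i \<otimes> D j i) = \<zero>" for j
    proof -
      interpret A: module R ?A by fact
      have "D j (?\<pi> z) = lin_comb R ?A (\<lambda>x. D j x) z"
        using B by (intro module_homs_lin_comb[OF M A D _ z]) auto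
      also have "\<dots> = (\<Oplus>i\<in>B. z i \<otimes> D j i)"
        using module_homsD(1)[OF D, of _ j] B(2) by (subst A.lin_comb_finite[OF B(1) z]) auto
      finally show ?thesis using module_homs_zero[OF M A D] z0 by simp
    qed
    have DR: "D j i \<in> carrier R" if "i \<in> B" for i j
      using module_homsD(1)[OF D, of i j] that B(2) by auto
    have "z b = \<zero>" if "b \<in> B"
      by (rule injective_if_identity_mod_nonunits[OF B(1) zD(1) DR near rel that])
    then show "z b = \<zero>\<^bsub>?E\<^esub> b" using zD(3) by (auto simp: free_module_simps)
  qed
  have "inj_on ?\<pi> (carrier ?E)"
  proof (rule inj_onI)
    fix x y assume xy: "x \<in> carrier ?E" "y \<in> carrier ?E" and eq: "?\<pi> x = ?\<pi> y"
    have "?\<pi> (x \<ominus>\<^bsub>?E\<^esub> y) = ?\<pi> x \<ominus>\<^bsub>M\<^esub> ?\<pi> y"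
      using xy by (rule module_homs_minus[OF E M \<pi>])
    also have "\<dots> = \<zero>\<^bsub>M\<^esub>" using eq module_homsD(1)[OF \<pi> xy(2)] by (simp add: M.M.minus_eq M.M.r_neg)
    finally have "x \<ominus>\<^bsub>?E\<^esub> y = \<zero>\<^bsub>?E\<^esub>" using xy by (intro ker) auto
    then have "x \<ominus>\<^bsub>?E\<^esub> y \<oplus>\<^bsub>?E\<^esub> y = y" using xy by simp
    then show "x = y" using xy by (simp add: E.M.minus_eq E.M.a_assoc E.M.l_neg)
  qed
  then show ?thesis using surjB B(2) by (auto simp: is_free_def bij_betw_def)
qed

section \<open>Symmetric presentations of torsionless modules\<close>

lemma matrix_map_hom:
  assumes R: "cring R" and A: "\<And>i j. i < n \<Longrightarrow> j < n \<Longrightarrow> A i j \<in> carrier R"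
  shows "matrix_map R n A \<in> module_homs R (free_module R {..<n}) (free_module R {..<n})"
proof -
  interpret cring R by fact
  let ?E = "free_module R {..<n}"
  note mem = free_module_memD(1)[OF R, where X = "{..<n}"]
  show ?thesis
  proof (rule module_homsI)
    fix x assume x: "x \<in> carrier ?E"
    show "matrix_map R n A x \<in> carrier ?E"
      using A mem[OF x] by (simp add: free_module_carrier_finite matrix_map_def Pi_iff)
  next
    fix x y assume x: "x \<in> carrier ?E" and y: "y \<in> carrier ?E"
    show "matrix_map R n A (x \<oplus>\<^bsub>?E\<^esub> y) = matrix_map R n A x \<oplus>\<^bsub>?E\<^esub> matrix_map R n A y"
    proof
      fix i
      have "(\<Oplus>\<^bsub>R\<^esub>j\<in>{..<n}. A i j \<otimes>\<^bsub>R\<^esub> (x j \<oplus>\<^bsub>R\<^esub> y j))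
          = (\<Oplus>\<^bsub>R\<^esub>j\<in>{..<n}. A i j \<otimes>\<^bsub>R\<^esub> x j \<oplus>\<^bsub>R\<^esub> A i j \<otimes>\<^bsub>R\<^esub> y j)" if "i < n"
        using A mem[OF x] mem[OF y] that by (intro finsum_cong') (auto simp: r_distr)
      also have "\<dots> = (\<Oplus>\<^bsub>R\<^esub>j\<in>{..<n}. A i j \<otimes>\<^bsub>R\<^esub> x j) \<oplus>\<^bsub>R\<^esub> (\<Oplus>\<^bsub>R\<^esub>j\<in>{..<n}. A i j \<otimes>\<^bsub>R\<^esub> y j)"
        if "i < n"
        by (rule finsum_addf) (simp_all add: Pi_iff A that mem[OF x] mem[OF y])
      finally show "matrix_map R n A (x \<oplus>\<^bsub>?E\<^esub> y) i
          = (matrix_map R n A x \<oplus>\<^bsub>?E\<^esub> matrix_map R n A y) i"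
        by (simp add: free_module_simps matrix_map_def)
    qed
  next
    fix a x assume a: "a \<in> carrier R" and x: "x \<in> carrier ?E"
    show "matrix_map R n A (a \<odot>\<^bsub>?E\<^esub> x) = a \<odot>\<^bsub>?E\<^esub> matrix_map R n A x"
    proof
      fix i
      have "(\<Oplus>\<^bsub>R\<^esub>j\<in>{..<n}. A i j \<otimes>\<^bsub>R\<^esub> (a \<otimes>\<^bsub>R\<^esub> x j))
          = (\<Oplus>\<^bsub>R\<^esub>j\<in>{..<n}. a \<otimes>\<^bsub>R\<^esub> (A i j \<otimes>\<^bsub>R\<^esub> x j))" if "i < n"
        using A mem[OF x] a that by (intro finsum_cong') (auto simp: m_lcomm)
      also have "\<dots> = a \<otimes>\<^bsub>R\<^esub> (\<Oplus>\<^bsub>R\<^esub>j\<in>{..<n}. A i j \<otimes>\<^bsub>R\<^esub> x j)" if "i < n"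
        by (rule finsum_rdistr[symmetric]) (simp_all add: Pi_iff A that mem[OF x] a)
      finally show "matrix_map R n A (a \<odot>\<^bsub>?E\<^esub> x) i = (a \<odot>\<^bsub>?E\<^esub> matrix_map R n A x) i"
        using a by (simp add: free_module_simps matrix_map_def)
    qed
  qed
qed

lemma matrix_map_free_gen:
  assumes R: "cring R" and A: "\<And>i j. i < n \<Longrightarrow> j < n \<Longrightarrow> A i j \<in> carrier R" and j: "j < n"
  shows "matrix_map R n A (free_gen R j) = (\<lambda>i. if i < n then A i j else \<zero>\<^bsub>R\<^esub>)"
proof
  interpret cring R by fact
  fix i
  have "(\<Oplus>\<^bsub>R\<^esub>k\<in>{..<n}. A i k \<otimes>\<^bsub>R\<^esub> free_gen R j k) = A i j" if i: "i < n"
  proof -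
    have "(\<Oplus>\<^bsub>R\<^esub>k\<in>{..<n}. A i k \<otimes>\<^bsub>R\<^esub> free_gen R j k)
        = (\<Oplus>\<^bsub>R\<^esub>k\<in>{..<n}. if j = k then A i k else \<zero>\<^bsub>R\<^esub>)"
      using A i by (intro finsum_cong') (auto simp: free_gen_def)
    also have "\<dots> = A i j"
      using A i j by (intro add.finprod_singleton) auto
    finally show ?thesis .
  qed
  then show "matrix_map R n A (free_gen R j) i = (if i < n then A i j else \<zero>\<^bsub>R\<^esub>)"
    by (simp add: matrix_map_def)
qed

text \<open>Evaluate \<open>\<psi>\<close> at chosen preimages under \<open>p\<close>. The kernel
  condition makes the value independent of the choice, and this independence also gives
  linearity.\<close>

lemma factor_through_surjection:
  assumes K: "module R K" and M: "module R M" and T: "module R T"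
    and p: "p \<in> module_homs R K M" and surj: "p ` carrier K = carrier M"
    and \<psi>: "\<psi> \<in> module_homs R K T"
    and ker: "\<And>x. x \<in> carrier K \<Longrightarrow> p x = \<zero>\<^bsub>M\<^esub> \<Longrightarrow> \<psi> x = \<zero>\<^bsub>T\<^esub>"
  obtains \<mu> where "\<mu> \<in> module_homs R M T" "\<And>x. x \<in> carrier K \<Longrightarrow> \<mu> (p x) = \<psi> x"
proof -
  interpret K: module R K by fact
  interpret M: module R M by fact
  interpret T: module R T by fact
  have "\<forall>y \<in> carrier M. \<exists>x \<in> carrier K. p x = y" using surj by (metis imageE)
  then obtain r where r: "\<And>y. y \<in> carrier M \<Longrightarrow> r y \<in> carrier K"
    "\<And>y. y \<in> carrier M \<Longrightarrow> p (r y) = y"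
    by metis
  have eq: "\<psi> x = \<psi> y" if x: "x \<in> carrier K" and y: "y \<in> carrier K" and "p x = p y" for x y
  proof -
    have "p (x \<ominus>\<^bsub>K\<^esub> y) = \<zero>\<^bsub>M\<^esub>"
      using that module_homsD(1)[OF p y] by (simp add: module_homs_minus[OF K M p] M.M.minus_eq M.M.r_neg)
    then have "\<psi> (x \<ominus>\<^bsub>K\<^esub> y) = \<zero>\<^bsub>T\<^esub>" using x y by (intro ker) auto
    then have "\<psi> (x \<ominus>\<^bsub>K\<^esub> y \<oplus>\<^bsub>K\<^esub> y) = \<psi> y"
      using x y module_homsD(1)[OF \<psi> y] by (simp add: module_homsD(2)[OF \<psi>])
    moreover have "x \<ominus>\<^bsub>K\<^esub> y \<oplus>\<^bsub>K\<^esub> y = x" using x y by (simp add: K.M.minus_eq K.M.a_assoc K.M.l_neg)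
    ultimately show ?thesis by simp
  qed
  show thesis
  proof (rule that[of "\<lambda>y. \<psi> (r y)"])
    show "(\<lambda>y. \<psi> (r y)) \<in> module_homs R M T"
    proof (rule module_homsI)
      show "\<psi> (r y) \<in> carrier T" if "y \<in> carrier M" for y
        using that r module_homsD(1)[OF \<psi>] by simp
      show "\<psi> (r (y \<oplus>\<^bsub>M\<^esub> y')) = \<psi> (r y) \<oplus>\<^bsub>T\<^esub> \<psi> (r y')"
        if "y \<in> carrier M" "y' \<in> carrier M" for y y'
        using that r eq[of "r (y \<oplus>\<^bsub>M\<^esub> y')" "r y \<oplus>\<^bsub>K\<^esub> r y'"]
        by (simp add: module_homsD(2)[OF \<psi>] module_homsD(2)[OF p])
      show "\<psi> (r (a \<odot>\<^bsub>M\<^esub> y)) = a \<odot>\<^bsub>T\<^esub> \<psi> (r y)" if "a \<in> carrier R" "y \<in> carrier M" for a y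
        using that r eq[of "r (a \<odot>\<^bsub>M\<^esub> y)" "a \<odot>\<^bsub>K\<^esub> r y"]
        by (simp add: module_homsD(3)[OF \<psi>] module_homsD(3)[OF p])
    qed
    show "\<psi> (r (p x)) = \<psi> x" if "x \<in> carrier K" for x
      using that r module_homsD(1)[OF p] by (intro eq) auto
  qed
qed

section \<open>Vanishing of Ext and lifting along short resolutions\<close>

context
  fixes R :: "('a, 'r) ring_scheme" (structure) and M :: "('a, 'b, 'm) module_scheme"
    and n :: nat and A :: "nat \<Rightarrow> nat \<Rightarrow> 'a" and p :: "(nat \<Rightarrow> 'a) \<Rightarrow> 'b"
  assumes M: "module R M" and torsionless: "torsionless R M"
    and entries: "\<And>i j. i < n \<Longrightarrow> j < n \<Longrightarrow> A i j \<in> carrier R"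
    and symmetric: "\<And>i j. i < n \<Longrightarrow> j < n \<Longrightarrow> A j i = A i j"
    and p: "p \<in> module_homs R (free_module R {..<n}) M"
    and p_surj: "p ` carrier (free_module R {..<n}) = carrier M"
    and exact: "a_kernel (free_module R {..<n}) M p
                  = matrix_map R n A ` carrier (free_module R {..<n})"
begin

interpretation module R M by (rule M)

private abbreviation (input) "E \<equiv> free_module R {..<n}"

private lemma E_module: "module R E"
  by (rule free_module_is_module[OF R.is_cring])

interpretation E: module R E by (rule E_module)

private lemmas A_hom = matrix_map_hom[OF R.is_cring entries]

text \<open>The columns of \<open>A\<close> are also its rows. Symmetry enters only through this
  formula: once to turn functionals on \<open>M\<close> into kernel vectors of \<open>A\<close>,
  once to read a system of equations row by row.\<close>

lemma matrix_map_symmetric_free_gen: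
  "j < n \<Longrightarrow> matrix_map R n A (free_gen R j) = (\<lambda>i. if i < n then A j i else \<zero>)"
  using matrix_map_free_gen[OF R.is_cring entries] symmetric by auto

private lemma p_matrix_map: "x \<in> carrier E \<Longrightarrow> p (matrix_map R n A x) = \<zero>\<^bsub>M\<^esub>"
  using exact by (auto simp: a_kernel_def')

text \<open>By symmetry, every functional on \<open>M\<close> gives an element of the kernel of \<open>A\<close>. So a vector
  orthogonal to this kernel has an image in \<open>M\<close> that is killed by all functionals.\<close>

lemma in_image_if_orthogonal_to_kernel:
  assumes f: "f \<in> carrier E"
    and orth: "\<And>x. x \<in> carrier E \<Longrightarrow> matrix_map R n A x = \<zero>\<^bsub>E\<^esub> \<Longrightarrow> (\<Oplus>i\<in>{..<n}. f i \<otimes> x i) = \<zero>"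
  shows "\<exists>w \<in> carrier E. f = matrix_map R n A w"
proof -
  let ?A = "regular_module R"
  have mA: "module R ?A" by (rule regular_module_is_module[OF R.is_cring])
  interpret A: module R ?A by fact
  have "\<phi> (p f) = \<phi> \<zero>\<^bsub>M\<^esub>" if "\<phi> \<in> carrier (dual_module R M)" for \<phi>
  proof -
    have \<phi>: "\<phi> \<in> module_homs R M ?A" using that by (simp add: dual_module_def hom_module_def)
    have \<phi>p: "(\<lambda>x. \<phi> (p x)) \<in> module_homs R E ?A" by (rule module_homs_comp[OF \<phi> p])
    \<comment> \<open>The coordinate vector of the functional \<open>\<phi> \<circ> p\<close>,
      padded by zeros to an element of the free module.\<close>
    define c where "c i = (if i < n then \<phi> (p (free_gen R i)) else \<zero>)" for i
    have cR: "c i \<in> carrier R" for i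
      using module_homsD(1)[OF \<phi>p free_gen_closed[OF R.is_cring, of i "{..<n}"]] by (simp add: c_def)
    have cE: "c \<in> carrier E" using cR by (simp add: free_module_carrier_finite) (simp add: c_def)
    have expand: "\<phi> (p x) = (\<Oplus>i\<in>{..<n}. x i \<otimes> c i)" if x: "x \<in> carrier E" for x
    proof -
      have "\<phi> (p x) = lin_comb R ?A (\<lambda>i. \<phi> (p (free_gen R i))) x"
        by (rule module_homs_free_eq[OF mA \<phi>p x])
      also have "\<dots> = lin_comb R ?A c x"
        by (intro lin_comb_cong[OF mA x]) (simp_all add: cR, simp add: c_def)
      also have "\<dots> = (\<Oplus>i\<in>{..<n}. x i \<otimes> c i)"
        using A.lin_comb_finite[OF _ x, of c] cR by simp
      finally show ?thesis .
    qed
    \<comment> \<open>By symmetry, entry \<open>j\<close> of the left side is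
      \<open>\<phi> \<circ> p\<close> evaluated at the \<open>j\<close>-th column of
      \<open>A\<close>, and \<open>p\<close> kills that column.\<close>
    have "matrix_map R n A c = \<zero>\<^bsub>E\<^esub>"
    proof
      fix j
      show "matrix_map R n A c j = \<zero>\<^bsub>E\<^esub> j"
      proof (cases "j < n")
        case True
        then have g: "free_gen R j \<in> carrier E" by (intro free_gen_closed[OF R.is_cring]) simp
        have "(\<Oplus>i\<in>{..<n}. A j i \<otimes> c i) = (\<Oplus>i\<in>{..<n}. matrix_map R n A (free_gen R j) i \<otimes> c i)"
          using True entries cR by (intro R.finsum_cong') (auto simp: matrix_map_symmetric_free_gen)
        also have "\<dots> = \<phi> (p (matrix_map R n A (free_gen R j)))"
          by (rule expand[symmetric]) (rule module_homsD(1)[OF A_hom g])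
        also have "\<dots> = \<zero>" using module_homs_zero[OF M mA \<phi>] by (simp add: p_matrix_map[OF g])
        finally show ?thesis using True by (simp add: matrix_map_def free_module_simps)
      qed (simp add: matrix_map_def free_module_simps)
    qed
    then show ?thesis using expand[OF f] orth[OF cE] module_homs_zero[OF M mA \<phi>] by simp
  qed
  \<comment> \<open>No functional separates \<open>p f\<close> from zero. Torsionlessness then gives
    \<open>p f = 0\<close>, and exactness puts \<open>f\<close> into the image of
    \<open>A\<close>.\<close>
  then have "bidual_map R M (p f) = bidual_map R M \<zero>\<^bsub>M\<^esub>"
    by (auto simp: bidual_map_def)
  then have "p f = \<zero>\<^bsub>M\<^esub>"
    using torsionless module_homsD(1)[OF p f] by (auto simp: torsionless_def dest: inj_onD)
  then have "f \<in> matrix_map R n A ` carrier E" using f exact by (auto simp: a_kernel_def')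
  then show ?thesis by blast
qed

text \<open>In other words, \<open>Ext\<^sup>1(M, P) = 0\<close>. Embedding \<open>P\<close> as a direct summand in the free module on its
  elements reduces the claim to the coordinates, that is, to \<open>P = R\<close>.\<close>

lemma projective_factorization:
  fixes P :: "('a, 'u) module"
  assumes P: "projective R P" and \<beta>: "\<And>j. j < n \<Longrightarrow> \<beta> j \<in> carrier P"
    and ker: "\<And>x. x \<in> carrier E \<Longrightarrow> matrix_map R n A x = \<zero>\<^bsub>E\<^esub> \<Longrightarrow> lin_comb R P \<beta> x = \<zero>\<^bsub>P\<^esub>"
  obtains \<gamma> where "\<And>i. i < n \<Longrightarrow> \<gamma> i \<in> carrier P"
    "\<And>x. x \<in> carrier E \<Longrightarrow> lin_comb R P \<gamma> (matrix_map R n A x) = lin_comb R P \<beta> x"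
proof -
  have mP: "module R P" using P by (simp add: projective_def)
  interpret P: module R P by fact
  let ?A = "regular_module R" and ?F = "free_module R (carrier P)"
  have mA: "module R ?A" by (rule regular_module_is_module[OF R.is_cring])
  interpret A: module R ?A by fact
  have mF: "module R ?F" by (rule free_module_is_module[OF R.is_cring])
  interpret F: module R ?F by fact
  let ?\<pi> = "lin_comb R P (\<lambda>q. q)"
  have \<pi>: "?\<pi> \<in> module_homs R ?F P" by (rule P.lin_comb_hom)
  have "submodule_span R P (carrier P) = carrier P"
    by (intro subset_antisym submodule_span_minimal submodule_span_superset
        P.carrier_is_submodule subset_refl)
  then have "?\<pi> ` carrier ?F = carrier P" by (intro P.lin_comb_surj_if_generating) auto
  moreover have "(\<lambda>q. q) \<in> module_homs R P P" by (rule module_homsI) auto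
  ultimately obtain s where s: "s \<in> module_homs R P ?F"
    and \<pi>s: "\<And>q. q \<in> carrier P \<Longrightarrow> ?\<pi> (s q) = q"
    using projective_lifting[OF P mF mP \<pi>] by blast
  have s\<beta>: "s (\<beta> j) \<in> carrier ?F" if "j < n" for j using that \<beta> module_homsD(1)[OF s] by simp
  \<comment> \<open>For each element \<open>c\<close> of \<open>P\<close>, \<open>f c\<close>
    collects the \<open>c\<close>-th coordinates of the vectors \<open>s (\<beta> j)\<close> into
    one \<open>n\<close>-tuple over \<open>R\<close>.\<close>
  define f where "f c j = (if j < n then s (\<beta> j) c else \<zero>)" for c j
  have fR: "f c j \<in> carrier R" for c j
    using free_module_memD(1)[OF R.is_cring s\<beta>] by (simp add: f_def)
  have fE: "f c \<in> carrier E" for c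
    using fR by (simp add: free_module_carrier_finite) (simp add: f_def)
  \<comment> \<open>The pairing of \<open>f c\<close> with a kernel vector \<open>x\<close> is the
    \<open>c\<close>-th coordinate of \<open>s (lin_comb R P \<beta> x)\<close>, which vanishes by
    \<open>ker\<close>.\<close>
  have "\<exists>w \<in> carrier E. f c = matrix_map R n A w" for c
  proof (rule in_image_if_orthogonal_to_kernel[OF fE])
    fix x assume x: "x \<in> carrier E" and "matrix_map R n A x = \<zero>\<^bsub>E\<^esub>"
    then have "s (lin_comb R P \<beta> x) c = \<zero>"
      using ker module_homs_zero[OF mP mF s] by (simp add: free_module_simps)
    moreover have "s (lin_comb R P \<beta> x) c = lin_comb R ?A (\<lambda>j. s (\<beta> j) c) x"
      using \<beta> by (intro module_homs_lin_comb[OF mP mA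
            module_homs_comp[OF free_module_eval_hom[OF R.is_cring] s] _ x]) auto
    moreover have "\<dots> = lin_comb R ?A (f c) x"
      by (intro lin_comb_cong[OF mA x]) (simp_all add: fR, simp add: f_def)
    moreover have "\<dots> = (\<Oplus>i\<in>{..<n}. x i \<otimes> f c i)"
      using A.lin_comb_finite[OF _ x, of "f c"] fR by simp
    moreover have "\<dots> = (\<Oplus>i\<in>{..<n}. f c i \<otimes> x i)"
      using fR free_module_memD(1)[OF R.is_cring x] by (intro R.finsum_cong') (auto simp: R.m_comm)
    ultimately show "(\<Oplus>i\<in>{..<n}. f c i \<otimes> x i) = \<zero>" by simp
  qed
  \<comment> \<open>Choosing the zero solution whenever \<open>f c\<close> is zero leaves only
    finitely many nonzero \<open>w c\<close>. Otherwise the elements \<open>\<Gamma> i\<close> below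
    need not have finite support.\<close>
  then have "\<forall>c. \<exists>w. w \<in> carrier E \<and> f c = matrix_map R n A w \<and> (f c = \<zero>\<^bsub>E\<^esub> \<longrightarrow> w = \<zero>\<^bsub>E\<^esub>)"
  proof (intro allI)
    fix c
    assume ex: "\<And>c. \<exists>w \<in> carrier E. f c = matrix_map R n A w"
    show "\<exists>w. w \<in> carrier E \<and> f c = matrix_map R n A w \<and> (f c = \<zero>\<^bsub>E\<^esub> \<longrightarrow> w = \<zero>\<^bsub>E\<^esub>)"
    proof (cases "f c = \<zero>\<^bsub>E\<^esub>")
      case True
      then show ?thesis
        by (intro exI[of _ "\<zero>\<^bsub>E\<^esub>"]) (simp add: module_homs_zero[OF E_module E_module A_hom])
    next
      case False
      then show ?thesis using ex[of c] by auto
    qed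
  qed
  then obtain w where wE: "\<And>c. w c \<in> carrier E" and fw: "\<And>c. f c = matrix_map R n A (w c)"
    and w0: "\<And>c. f c = \<zero>\<^bsub>E\<^esub> \<Longrightarrow> w c = \<zero>\<^bsub>E\<^esub>"
    by metis
  have wR: "w c i \<in> carrier R" for c i by (rule free_module_memD(1)[OF R.is_cring wE])
  \<comment> \<open>The family \<open>w\<close> transposed: its \<open>i\<close>-th entries over all
    \<open>c\<close> form one element of the free module on \<open>P\<close>.\<close>
  define \<Gamma> where "\<Gamma> i c = w c i" for i c
  have \<Gamma>: "\<Gamma> i \<in> carrier ?F" for i
  proof -
    have "\<exists>j<n. s (\<beta> j) c \<noteq> \<zero>" if "\<Gamma> i c \<noteq> \<zero>" for c
    proof (rule ccontr)
      assume "\<not> ?thesis"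
      then have "f c = \<zero>\<^bsub>E\<^esub>" by (auto simp: f_def free_module_simps)
      from w0[OF this] that show False by (simp add: \<Gamma>_def free_module_simps)
    qed
    then have "{c. \<Gamma> i c \<noteq> \<zero>} \<subseteq> (\<Union>j<n. {c. s (\<beta> j) c \<noteq> \<zero>})" by auto
    moreover have "(\<Union>j<n. {c. s (\<beta> j) c \<noteq> \<zero>}) \<subseteq> carrier P"
      using free_module_memD(3)[OF R.is_cring s\<beta>] by blast
    moreover have "finite (\<Union>j<n. {c. s (\<beta> j) c \<noteq> \<zero>})"
      using free_module_memD(2)[OF R.is_cring s\<beta>] by auto
    ultimately have "finite {c. \<Gamma> i c \<noteq> \<zero>}" "{c. \<Gamma> i c \<noteq> \<zero>} \<subseteq> carrier P"
      by (auto dest: finite_subset)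
    then show ?thesis using wR by (auto simp: free_module_def \<Gamma>_def)
  qed
  define \<gamma> where "\<gamma> i = ?\<pi> (\<Gamma> i)" for i
  have \<gamma>: "\<gamma> i \<in> carrier P" for i unfolding \<gamma>_def by (rule module_homsD(1)[OF \<pi> \<Gamma>])
  have \<gamma>_hom: "lin_comb R P \<gamma> \<in> module_homs R E P" by (rule P.lin_comb_hom) (rule \<gamma>)
  have \<beta>_hom: "lin_comb R P \<beta> \<in> module_homs R E P" using \<beta> by (intro P.lin_comb_hom) auto
  show thesis
  proof (rule that[OF \<gamma>])
    fix x assume x: "x \<in> carrier E"
    show "lin_comb R P \<gamma> (matrix_map R n A x) = lin_comb R P \<beta> x"
    proof (rule module_homs_free_eqI[OF mP module_homs_comp[OF \<gamma>_hom A_hom] \<beta>_hom _ x])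
      fix j assume jn: "j \<in> {..<n}"
      then have j: "j < n" by simp
      let ?a = "matrix_map R n A (free_gen R j)"
      have a: "?a \<in> carrier E"
        by (rule module_homsD(1)[OF A_hom free_gen_closed[OF R.is_cring jn]])
      \<comment> \<open>In coordinate \<open>c\<close>, symmetry turns the left side into entry
        \<open>j\<close> of \<open>A\<close> applied to \<open>w c\<close>, that is,
        \<open>f c j\<close>.\<close>
      have "lin_comb R ?F \<Gamma> ?a = s (\<beta> j)"
      proof
        fix c
        have "lin_comb R ?F \<Gamma> ?a c = lin_comb R ?A (\<lambda>i. \<Gamma> i c) ?a"
          by (rule module_homs_lin_comb[OF mF mA free_module_eval_hom[OF R.is_cring] \<Gamma> a])
        also have "\<dots> = (\<Oplus>i\<in>{..<n}. ?a i \<otimes> w c i)"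
          using A.lin_comb_finite[OF _ a, of "\<lambda>i. \<Gamma> i c"] wR by (simp add: \<Gamma>_def)
        also have "\<dots> = (\<Oplus>i\<in>{..<n}. A j i \<otimes> w c i)"
          using j wR entries by (intro R.finsum_cong') (auto simp: matrix_map_symmetric_free_gen)
        also have "\<dots> = f c j" using j by (simp add: fw matrix_map_def)
        finally show "lin_comb R ?F \<Gamma> ?a c = s (\<beta> j) c" using j by (simp add: f_def)
      qed
      then have "?\<pi> (lin_comb R ?F \<Gamma> ?a) = \<beta> j" using j \<beta> \<pi>s by simp
      moreover have "?\<pi> (lin_comb R ?F \<Gamma> ?a) = lin_comb R P \<gamma> ?a"
        unfolding \<gamma>_def by (rule module_homs_lin_comb[OF mF mP \<pi> \<Gamma> a])
      moreover have "lin_comb R P \<beta> (free_gen R j) = \<beta> j"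
        using j \<beta> by (intro P.lin_comb_free_gen) simp
      ultimately show "lin_comb R P \<gamma> ?a = lin_comb R P \<beta> (free_gen R j)" by simp
    qed
  qed
qed

text \<open>The obstruction to lifting \<open>\<tau>\<close> lies in
  \<open>Ext\<^sup>1(M, P1) = 0\<close>. Concretely, a lift of \<open>\<tau> \<circ> p\<close> to
  \<open>P0\<close> fails to vanish on the image of \<open>A\<close> by a map into
  \<open>P1\<close>; that map extends along \<open>A\<close> and is subtracted.\<close>

lemma lifts_through_short_resolution:
  fixes P0 P1 :: "('a, 'u) module"
  assumes L: "module R L" and P0: "module R P0" and P1: "projective R P1"
    and d: "d \<in> module_homs R P1 P0" and d_inj: "\<And>y. y \<in> carrier P1 \<Longrightarrow> d y = \<zero>\<^bsub>P0\<^esub> \<Longrightarrow> y = \<zero>\<^bsub>P1\<^esub>"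
    and e: "e \<in> module_homs R P0 L" and e_surj: "e ` carrier P0 = carrier L"
    and e_ker: "a_kernel P0 L e = d ` carrier P1"
    and \<tau>: "\<tau> \<in> module_homs R M L"
  shows "\<exists>\<mu> \<in> module_homs R M P0. \<forall>x \<in> carrier M. e (\<mu> x) = \<tau> x"
proof -
  have mP1: "module R P1" using P1 by (simp add: projective_def)
  interpret P0: module R P0 by fact
  interpret P1: module R P1 by fact
  interpret L: module R L by fact
  have gen: "free_gen R i \<in> carrier E" if "i < n" for i
    using that by (intro free_gen_closed[OF R.is_cring]) simp
  have \<tau>p: "(\<lambda>x. \<tau> (p x)) \<in> module_homs R E L" by (rule module_homs_comp[OF \<tau> p])
  have "\<forall>i<n. \<exists>u \<in> carrier P0. e u = \<tau> (p (free_gen R i))"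
    using module_homsD(1)[OF \<tau>p gen] e_surj by (metis imageE)
  then obtain u where u: "\<And>i. i < n \<Longrightarrow> u i \<in> carrier P0"
    and eu: "\<And>i. i < n \<Longrightarrow> e (u i) = \<tau> (p (free_gen R i))"
    by metis
  let ?l = "lin_comb R P0 u"
  have l: "?l \<in> module_homs R E P0" using u by (intro P0.lin_comb_hom) auto
  have el: "e (?l x) = \<tau> (p x)" if x: "x \<in> carrier E" for x
    using u eu by (intro module_homs_free_eqI[OF L module_homs_comp[OF e l] \<tau>p _ x])
      (simp add: P0.lin_comb_free_gen)
  \<comment> \<open>On the columns of \<open>A\<close> the lift \<open>?l\<close> takes values in
    the kernel of \<open>e\<close>, since \<open>p\<close> kills them; exactness pulls these values
    back to \<open>P1\<close>.\<close>
  have "\<forall>j<n. \<exists>b \<in> carrier P1. d b = ?l (matrix_map R n A (free_gen R j))"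
  proof (intro allI impI)
    fix j assume "j < n"
    note g = gen[OF this]
    have a: "matrix_map R n A (free_gen R j) \<in> carrier E" by (rule module_homsD(1)[OF A_hom g])
    have "e (?l (matrix_map R n A (free_gen R j))) = \<zero>\<^bsub>L\<^esub>"
      using el[OF a] p_matrix_map[OF g] module_homs_zero[OF M L \<tau>] by simp
    then have "?l (matrix_map R n A (free_gen R j)) \<in> d ` carrier P1"
      using e_ker module_homsD(1)[OF l a] by (auto simp: a_kernel_def')
    then show "\<exists>b \<in> carrier P1. d b = ?l (matrix_map R n A (free_gen R j))" by force
  qed
  then obtain \<beta> where \<beta>: "\<And>j. j < n \<Longrightarrow> \<beta> j \<in> carrier P1"
    and d\<beta>: "\<And>j. j < n \<Longrightarrow> d (\<beta> j) = ?l (matrix_map R n A (free_gen R j))"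
    by metis
  have \<beta>_hom: "lin_comb R P1 \<beta> \<in> module_homs R E P1" using \<beta> by (intro P1.lin_comb_hom) auto
  have d\<beta>_all: "d (lin_comb R P1 \<beta> x) = ?l (matrix_map R n A x)" if x: "x \<in> carrier E" for x
  proof (rule module_homs_free_eqI[OF P0 module_homs_comp[OF d \<beta>_hom] module_homs_comp[OF l A_hom] _ x])
    fix j assume "j \<in> {..<n}"
    then have "j < n" by simp
    then show "d (lin_comb R P1 \<beta> (free_gen R j)) = ?l (matrix_map R n A (free_gen R j))"
      by (simp add: P1.lin_comb_free_gen \<beta> d\<beta>)
  qed
  \<comment> \<open>Injectivity of \<open>d\<close> transfers the vanishing from \<open>P0\<close>
    to \<open>P1\<close>.\<close>
  have \<beta>_ker: "lin_comb R P1 \<beta> x = \<zero>\<^bsub>P1\<^esub>"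
    if x: "x \<in> carrier E" and "matrix_map R n A x = \<zero>\<^bsub>E\<^esub>" for x
    using d\<beta>_all[OF x] that module_homs_zero[OF E_module P0 l] module_homsD(1)[OF \<beta>_hom x]
    by (intro d_inj) auto
  obtain \<gamma> where \<gamma>: "\<And>i. i < n \<Longrightarrow> \<gamma> i \<in> carrier P1"
    and \<gamma>\<beta>: "\<And>x. x \<in> carrier E \<Longrightarrow> lin_comb R P1 \<gamma> (matrix_map R n A x) = lin_comb R P1 \<beta> x"
    using projective_factorization[OF P1 \<beta> \<beta>_ker] by metis
  have \<gamma>_hom: "lin_comb R P1 \<gamma> \<in> module_homs R E P1" using \<gamma> by (intro P1.lin_comb_hom) auto
  note d\<gamma> = module_homs_comp[OF d \<gamma>_hom]
  \<comment> \<open>The corrected lift: the two terms agree on the image of \<open>A\<close>, which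
    is the kernel of \<open>p\<close>, so \<open>\<psi>\<close> descends to
    \<open>M\<close>.\<close>
  define \<psi> where "\<psi> x = ?l x \<ominus>\<^bsub>P0\<^esub> d (lin_comb R P1 \<gamma> x)" for x
  have \<psi>: "\<psi> \<in> module_homs R E P0"
    unfolding \<psi>_def by (rule module_homs_diff[OF E_module P0 l d\<gamma>])
  have \<psi>_ker: "\<psi> x = \<zero>\<^bsub>P0\<^esub>" if "x \<in> carrier E" "p x = \<zero>\<^bsub>M\<^esub>" for x
  proof -
    have "x \<in> a_kernel E M p" using that by (simp add: a_kernel_def')
    then obtain y where y: "y \<in> carrier E" "x = matrix_map R n A y" using exact by auto
    have "\<psi> x = ?l x \<ominus>\<^bsub>P0\<^esub> ?l x" by (simp add: \<psi>_def y \<gamma>\<beta> d\<beta>_all)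
    then show ?thesis using module_homsD(1)[OF l that(1)] by (simp add: P0.M.minus_eq P0.M.r_neg)
  qed
  \<comment> \<open>The correction lies in the image of \<open>d\<close>, which \<open>e\<close>
    kills; so \<open>\<psi>\<close> still lifts \<open>\<tau> \<circ> p\<close>.\<close>
  have e\<psi>: "e (\<psi> x) = \<tau> (p x)" if x: "x \<in> carrier E" for x
  proof -
    have "d (lin_comb R P1 \<gamma> x) \<in> a_kernel P0 L e"
      using e_ker module_homsD(1)[OF \<gamma>_hom x] by auto
    then have "e (d (lin_comb R P1 \<gamma> x)) = \<zero>\<^bsub>L\<^esub>" by (simp add: a_kernel_def')
    then have "e (\<psi> x) = \<tau> (p x) \<ominus>\<^bsub>L\<^esub> \<zero>\<^bsub>L\<^esub>"
      unfolding \<psi>_def using module_homs_minus[OF P0 L e module_homsD(1)[OF l x] module_homsD(1)[OF d\<gamma> x]]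
      by (simp add: el[OF x])
    then show ?thesis using module_homsD(1)[OF \<tau>p x] by (simp add: L.M.minus_eq)
  qed
  obtain \<mu> where \<mu>: "\<mu> \<in> module_homs R M P0" and \<mu>p: "\<And>x. x \<in> carrier E \<Longrightarrow> \<mu> (p x) = \<psi> x"
  proof (rule factor_through_surjection[OF E_module M P0 p p_surj \<psi>])
    show "\<psi> x = \<zero>\<^bsub>P0\<^esub>" if "x \<in> carrier E" "p x = \<zero>\<^bsub>M\<^esub>" for x
      by (rule \<psi>_ker[OF that])
  qed (rule that)
  have "e (\<mu> y) = \<tau> y" if "y \<in> carrier M" for y
  proof -
    have "y \<in> p ` carrier E" using that p_surj by simp
    then obtain x where x: "x \<in> carrier E" "y = p x" by (rule imageE)
    show ?thesis unfolding x(2) using e\<psi>[OF x(1)] \<mu>p[OF x(1)] by simp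
  qed
  with \<mu> show ?thesis by blast
qed

end

section \<open>Resolutions of length one and the conclusion\<close>

lemma proj_dim_eq_1E:
  fixes R :: "('a, 'r) ring_scheme" and L :: "('a, 'l, 'm) module_scheme"
  assumes "proj_dim R L = 1"
  obtains P0 P1 :: "('a, nat + 'a + 'l \<Rightarrow> 'a) module" and d e
  where "projective R P0" "projective R P1" "d \<in> module_homs R P1 P0" "e \<in> module_homs R P0 L"
    "\<And>y. y \<in> carrier P1 \<Longrightarrow> d y = \<zero>\<^bsub>P0\<^esub> \<Longrightarrow> y = \<zero>\<^bsub>P1\<^esub>"
    "e ` carrier P0 = carrier L" "a_kernel P0 L e = d ` carrier P1"
proof -
  define S where "S = {n. \<exists>(P :: nat \<Rightarrow> ('a, nat + 'a + 'l \<Rightarrow> 'a) module) d e.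
        projective_resolution R L P d e \<and> (\<forall>i>n. carrier (P i) = {\<zero>\<^bsub>P i\<^esub>})}"
  have Inf: "Inf (enat ` S) = 1" using assms by (simp add: proj_dim_def S_def)
  \<comment> \<open>The infimum of the empty set is \<open>\<infinity>\<close>, so value 1 forces a
    finite resolution to exist; the infimum of a nonempty set of naturals is attained.\<close>
  then have "enat ` S \<noteq> {}" by (auto simp: Inf_enat_def)
  then have "Inf (enat ` S) \<in> enat ` S" unfolding Inf_enat_def by (auto intro: LeastI)
  then have "1 \<in> S" by (auto simp: Inf one_enat_def)
  then obtain P :: "nat \<Rightarrow> ('a, nat + 'a + 'l \<Rightarrow> 'a) module" and d e
    where res: "projective_resolution R L P d e" and fin: "\<And>i. i > 1 \<Longrightarrow> carrier (P i) = {\<zero>\<^bsub>P i\<^esub>}"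
    unfolding S_def by blast
  have proj: "projective R (P i)" and d: "d i \<in> module_homs R (P (Suc i)) (P i)"
    and ker: "a_kernel (P (Suc i)) (P i) (d i) = d (Suc i) ` carrier (P (Suc (Suc i)))" for i
    using res by (auto simp: projective_resolution_def)
  \<comment> \<open>As \<open>P 2\<close> is zero, exactness at \<open>P 1\<close> makes
    \<open>d 0\<close> injective.\<close>
  have "a_kernel (P 1) (P 0) (d 0) = {d 1 \<zero>\<^bsub>P 2\<^esub>}"
    using ker[of 0] fin[of 2] by (simp add: numeral_2_eq_2)
  also have "d 1 \<zero>\<^bsub>P 2\<^esub> = \<zero>\<^bsub>P 1\<^esub>"
    using module_homs_zero[of R "P 2" "P 1" "d 1"] proj d[of 1]
    by (simp add: numeral_2_eq_2 projective_def)
  finally have inj: "y = \<zero>\<^bsub>P 1\<^esub>" if "y \<in> carrier (P 1)" "d 0 y = \<zero>\<^bsub>P 0\<^esub>" for y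
    using that by (auto simp: a_kernel_def')
  show thesis
    by (rule that[OF proj proj _ _ inj]) (use res d[of 0] in \<open>auto simp: projective_resolution_def\<close>)
qed

theorem proposition7p4:
  fixes R :: "('a, 'r) ring_scheme"
    and M :: "('a, 'b, 'm) module_scheme"
    and N :: "('a, 'c, 'k) module_scheme"
    and n :: nat
    and A :: "nat \<Rightarrow> nat \<Rightarrow> 'a"
    and p :: "(nat \<Rightarrow> 'a) \<Rightarrow> 'b"
  assumes "noetherian_ring R" and "local_ring R"
    and "module R M" and "finitely_generated R M"
    and "\<not> is_free R M" and "torsionless R M"
    and entries: "\<And>i j. i < n \<Longrightarrow> j < n \<Longrightarrow> A i j \<in> carrier R"
    and symmetric: "\<And>i j. i < n \<Longrightarrow> j < n \<Longrightarrow> A j i = A i j"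
    and p_hom: "p \<in> module_homs R (free_module R {..<n}) M"
    and p_surj: "p ` carrier (free_module R {..<n}) = carrier M"
    and exact: "a_kernel (free_module R {..<n}) M p
                  = matrix_map R n A ` carrier (free_module R {..<n})"
    and "module R N" and "finitely_generated R N" and "carrier N \<noteq> {\<zero>\<^bsub>N\<^esub>}"
  shows "proj_dim R (tensor_product R M N) \<noteq> 1"
proof
  assume "proj_dim R (tensor_product R M N) = 1"
  then obtain P0 P1 :: "('a, nat + 'a + ('b \<times> 'c \<Rightarrow> 'a) set \<Rightarrow> 'a) module" and d e
    where P0: "projective R P0" and P1: "projective R P1"
      and d: "d \<in> module_homs R P1 P0" and e: "e \<in> module_homs R P0 (tensor_product R M N)"
      and d_inj: "\<And>y. y \<in> carrier P1 \<Longrightarrow> d y = \<zero>\<^bsub>P0\<^esub> \<Longrightarrow> y = \<zero>\<^bsub>P1\<^esub>"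
      and e_surj: "e ` carrier P0 = carrier (tensor_product R M N)"
      and e_ker: "a_kernel P0 (tensor_product R M N) e = d ` carrier P1"
    by (rule proj_dim_eq_1E) blast
  have mP0: "module R P0" using P0 by (simp add: projective_def)
  note T = tensor_product_is_module[OF \<open>module R M\<close> \<open>module R N\<close>]
  \<comment> \<open>The length-one resolution lets every map from \<open>M\<close> to the tensor
    product lift along \<open>e\<close>; with \<open>N\<close> nonzero this makes \<open>M\<close>
    free, against the assumption.\<close>
  have "is_free R M"
  proof (rule local_ring.free_if_tensor_lifts[OF \<open>local_ring R\<close> \<open>module R M\<close>
        \<open>finitely_generated R M\<close> \<open>module R N\<close> \<open>finitely_generated R N\<close> _ P0 e])
    fix \<tau> assume \<tau>: "\<tau> \<in> module_homs R M (tensor_product R M N)"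
    show "\<exists>\<mu> \<in> module_homs R M P0. \<forall>x \<in> carrier M. e (\<mu> x) = \<tau> x"
      by (rule lifts_through_short_resolution[OF \<open>module R M\<close> \<open>torsionless R M\<close> entries symmetric
            p_hom p_surj exact T mP0 P1 d d_inj e e_surj e_ker \<tau>])
  qed fact
  with \<open>\<not> is_free R M\<close> show False by contradiction
qed

end
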